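(* Let $k\in\mathbb{N}$, let $\alpha$ and $\beta$ be two inner functions and let $\varphi\in L^2$. If $\varphi\in \overline{\alpha H^2}+(W_k^*\beta) H^2$, then $U_{\varphi}^{\alpha,\beta}=0$.
   Context: $\mathbb{T}$ is the unit circle, $L^2=L^2(\mathbb{T})$, $H^2\subset L^2$ the Hardy space of the unit disk. $\mathbb{N}=\{1,2,\dots\}$. An inner function is a bounded analytic function in the disk with boundary values of modulus one a.e. on $\mathbb{T}$. $K_\alpha=H^2\ominus\alpha H^2$, $K_\alpha^\infty=K_\alpha\cap H^\infty$ (dense in $K_\alpha$), $P_\alpha$ is the orthogonal projection of $L^2$ onto $K_\alpha$. $W_k$ is the bounded operator on $L^2$ with $W_k(z^n)=z^{n/k}$ if $k$ divides $n$ and $W_k(z^n)=0$ otherwise ($n\in\mathbb{Z}$); its adjoint is $W_k^*f(z)=f(z^k)$. For $\varphi\in L^2$, $U_\varphi^{\alpha,\beta}f=P_\beta W_k(\varphi f)$ for $f\in K_\alpha^\infty$. $\overline{\alpha H^2}=\{\overline{\alpha h}:h\in H^2\}$ (complex conjugates). *)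

theory Defs
  imports "HOL-Complex_Analysis.Complex_Analysis"
begin

text \<open>
  Elements of \<open>L\<^sup>2(\<T>)\<close> are represented by Borel functions on the unit circle.  No quotient is taken:
  equality of classes is written as equality almost everywhere, and every set of functions below
  that stands for a subset of \<open>L\<^sup>2\<close> consists of all representatives of its classes.
\<close>

text \<open>Normalized arc length; its underlying space is the unit circle.\<close>

definition circle :: "complex measure" where
  "circle = distr (uniform_measure lborel {0..2 * pi}) (restrict_space borel (sphere 0 1)) cis"

definition L2 :: "(complex \<Rightarrow> complex) set" where
  "L2 = {f \<in> borel_measurable circle. integrable circle (\<lambda>z. (cmod (f z))\<^sup>2)}"

definition L2_inner :: "(complex \<Rightarrow> complex) \<Rightarrow> (complex \<Rightarrow> complex) \<Rightarrow> complex" where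
  "L2_inner f g = (LINT z|circle. f z * cnj (g z))"

definition L2_norm :: "(complex \<Rightarrow> complex) \<Rightarrow> real" where
  "L2_norm f = sqrt (LINT z|circle. (cmod (f z))\<^sup>2)"

definition L2_mult :: "(complex \<Rightarrow> complex) \<Rightarrow> (complex \<Rightarrow> complex) set \<Rightarrow> (complex \<Rightarrow> complex) set" where
  "L2_mult u S = {f \<in> L2. \<exists>h\<in>S. AE z in circle. f z = u z * h z}"

definition L2_cnj :: "(complex \<Rightarrow> complex) set \<Rightarrow> (complex \<Rightarrow> complex) set" where
  "L2_cnj S = {f \<in> L2. \<exists>h\<in>S. AE z in circle. f z = cnj (h z)}"

definition L2_plus ::
    "(complex \<Rightarrow> complex) set \<Rightarrow> (complex \<Rightarrow> complex) set \<Rightarrow> (complex \<Rightarrow> complex) set" where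
  "L2_plus S T = {f \<in> L2. \<exists>g\<in>S. \<exists>h\<in>T. AE z in circle. f z = g z + h z}"

definition radial_tendsto :: "(complex \<Rightarrow> complex) \<Rightarrow> complex \<Rightarrow> complex \<Rightarrow> bool" where
  "radial_tendsto F z l \<longleftrightarrow> ((\<lambda>r::real. F (of_real r * z)) \<longlongrightarrow> l) (at_left 1)"

text \<open>
  The Hardy spaces of the unit disk, viewed inside \<open>L\<^sup>2\<close> by passing from an analytic function on
  the disk to its radial boundary values.
\<close>

definition H2 :: "(complex \<Rightarrow> complex) set" where
  "H2 = {f \<in> L2. \<exists>F. F holomorphic_on ball 0 1 \<and>
           (\<exists>C. \<forall>r\<in>{0..<1::real}. (LINT z|circle. (cmod (F (of_real r * z)))\<^sup>2) \<le> C) \<and>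
           (AE z in circle. radial_tendsto F z (f z))}"

definition Hinf :: "(complex \<Rightarrow> complex) set" where
  "Hinf = {f \<in> L2. \<exists>F. F holomorphic_on ball 0 1 \<and> bounded (F ` ball 0 1) \<and>
           (AE z in circle. radial_tendsto F z (f z))}"

text \<open>Inner functions are functions on the disk; \<open>bval \<alpha>\<close> is the boundary function of \<open>\<alpha>\<close>.\<close>

definition inner_function :: "(complex \<Rightarrow> complex) \<Rightarrow> bool" where
  "inner_function \<alpha> \<longleftrightarrow> \<alpha> holomorphic_on ball 0 1 \<and> bounded (\<alpha> ` ball 0 1) \<and>
     (AE z in circle. \<exists>l. radial_tendsto \<alpha> z l \<and> cmod l = 1)"

definition bval :: "(complex \<Rightarrow> complex) \<Rightarrow> complex \<Rightarrow> complex" where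
  "bval \<alpha> z = (THE l. radial_tendsto \<alpha> z l)"

definition model_space :: "(complex \<Rightarrow> complex) \<Rightarrow> (complex \<Rightarrow> complex) set" where
  "model_space \<alpha> = {f \<in> H2. \<forall>g \<in> L2_mult (bval \<alpha>) H2. L2_inner f g = 0}"

definition model_space_inf :: "(complex \<Rightarrow> complex) \<Rightarrow> (complex \<Rightarrow> complex) set" where
  "model_space_inf \<alpha> = model_space \<alpha> \<inter> Hinf"

text \<open>
  Orthogonal projection of \<open>L\<^sup>2\<close> onto the model space.  The choice is only that of a representative:
  any two admissible \<open>g\<close> agree almost everywhere.
\<close>

definition model_proj :: "(complex \<Rightarrow> complex) \<Rightarrow> (complex \<Rightarrow> complex) \<Rightarrow> complex \<Rightarrow> complex" where
  "model_proj \<alpha> f =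
     (SOME g. g \<in> model_space \<alpha> \<and> (\<forall>h\<in>model_space \<alpha>. L2_inner (\<lambda>z. f z - g z) h = 0))"

definition L2_bounded_op :: "((complex \<Rightarrow> complex) \<Rightarrow> complex \<Rightarrow> complex) \<Rightarrow> bool" where
  "L2_bounded_op T \<longleftrightarrow>
     (\<forall>f\<in>L2. T f \<in> L2) \<and>
     (\<forall>f\<in>L2. \<forall>g\<in>L2. \<forall>a b. AE z in circle. T (\<lambda>w. a * f w + b * g w) z = a * T f z + b * T g z) \<and>
     (\<exists>C. \<forall>f\<in>L2. L2_norm (T f) \<le> C * L2_norm f)"

text \<open>
  The operator \<open>W\<^sub>k\<close>.  Boundedness and the values on the monomials determine it up to equality
  almost everywhere, so that again only representatives are chosen.
\<close>

definition slant_op :: "nat \<Rightarrow> (complex \<Rightarrow> complex) \<Rightarrow> complex \<Rightarrow> complex" where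
  "slant_op k = (SOME T. L2_bounded_op T \<and>
     (\<forall>n::int. AE z in circle.
        T (\<lambda>w. w powi n) z = (if int k dvd n then z powi (n div int k) else 0)))"

text \<open>The adjoint \<open>W\<^sub>k\<^sup>*\<close>.\<close>

definition slant_adj :: "nat \<Rightarrow> (complex \<Rightarrow> complex) \<Rightarrow> complex \<Rightarrow> complex" where
  "slant_adj k f = (\<lambda>z. f (z ^ k))"

text \<open>The operator \<open>U\<^sub>\<phi>\<close> of order \<open>k\<close> from the model space of \<open>\<alpha>\<close> to that of \<open>\<beta>\<close>, with its domain.\<close>

definition trunc_slant :: "nat \<Rightarrow> (complex \<Rightarrow> complex) \<Rightarrow> (complex \<Rightarrow> complex) \<Rightarrow>
    (complex \<Rightarrow> complex) \<Rightarrow> (complex \<Rightarrow> complex) \<Rightarrow> complex \<Rightarrow> complex" where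
  "trunc_slant k \<alpha> \<beta> \<phi> =
     (\<lambda>f\<in>model_space_inf \<alpha>. model_proj \<beta> (slant_op k (\<lambda>z. \<phi> z * f z)))"

end

theory Submission
  imports Defs "HOL-Probability.Probability_Measure"
begin

text \<open>
  It suffices that \<open>W\<^sub>k (\<phi> f)\<close> is orthogonal to every \<open>g\<close> in the model space of \<open>\<beta>\<close>.  Write
  \<open>\<phi> = cnj u + v\<close> with \<open>u = \<alpha> h\<^sub>1\<close> and \<open>v = W\<^sub>k\<^sup>*\<beta> \<sqdot> h\<^sub>2\<close>.  Pairings with \<open>H\<^sup>2\<close> functions may be
  tested on the powers \<open>z\<^sup>n\<close>.  Taking \<open>z\<^sup>n\<close> for \<open>g\<close>, the first term gives \<open>\<langle>cnj u \<sqdot> f, z\<^bsup>kn\<^esup>\<rangle> = \<langle>f, \<alpha> h\<^sub>1 z\<^bsup>kn\<^esup>\<rangle> = 0\<close>.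
  Taking \<open>z\<^sup>n\<close> for \<open>h\<^sub>2 f \<in> H\<^sup>2\<close>, the second gives \<open>\<langle>W\<^sub>k z\<^sup>n, cnj \<beta> \<sqdot> g\<rangle>\<close>, which is \<open>0\<close> or, for \<open>n = km\<close>, equal to
  \<open>\<langle>\<beta> z\<^sup>m, g\<rangle> = 0\<close>.  The adjoint formula for \<open>W\<^sub>k\<close> and the rotation and power invariance of arc
  length follow from density of trigonometric polynomials; density of polynomials in \<open>H\<^sup>2\<close>
  follows from Parseval's identity on smaller circles and Fatou's lemma.
\<close>

section \<open>Arc length and trigonometric polynomials\<close>

lemma space_circle [simp]: "space circle = sphere 0 1"
  by (simp add: circle_def space_restrict_space)

lemma sets_circle [measurable_cong]: "sets circle = sets (restrict_space borel (sphere 0 1))"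
  by (simp add: circle_def)

lemma cis_measurable_sphere:
  "cis \<in> uniform_measure lborel {0..2 * pi} \<rightarrow>\<^sub>M restrict_space borel (sphere 0 1)"
proof (intro measurable_restrict_space2)
  have "cis \<in> borel_measurable borel"
    by (intro borel_measurable_continuous_onI continuous_intros)
  then show "cis \<in> borel_measurable (uniform_measure lborel {0..2 * pi})"
    by (simp cong: measurable_cong_sets)
qed auto

interpretation circle: prob_space circle
  unfolding circle_def
  by (intro prob_space.prob_space_distr prob_space_uniform_measure cis_measurable_sphere) auto

lemma continuous_imp_borel_circle:
  assumes "continuous_on (sphere 0 1) f"
  shows "f \<in> borel_measurable circle"
  using borel_measurable_continuous_on_restrict[OF assms]
  by (simp cong: measurable_cong_sets add: sets_circle)

lemma measurable_circle_iff:
  "f \<in> circle \<rightarrow>\<^sub>M circle \<longleftrightarrow> f \<in> borel_measurable circle \<and> (\<forall>z\<in>sphere 0 1. cmod (f z) = 1)"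
proof -
  have "f \<in> circle \<rightarrow>\<^sub>M circle \<longleftrightarrow> f \<in> circle \<rightarrow>\<^sub>M restrict_space borel (sphere 0 1)"
    by (simp cong: measurable_cong_sets add: sets_circle)
  then show ?thesis
    by (auto simp: measurable_restrict_space2_iff)
qed

text \<open>The fundamental theorem of calculus applies with antiderivative
  \<open>t / (2 * pi)\<close> for \<open>n = 0\<close> and
  \<open>cis (n * t) / (2 * pi * n * \<i>)\<close> otherwise. The latter takes equal values at both
  ends of the interval.\<close>

lemma integral_cis_of_int:
  "(LINT t|uniform_measure lborel {0..2*pi}. cis (of_int n * t)) = (if n = 0 then 1 else 0)"
proof -
  have m: "(\<lambda>t. cis (of_int n * t)) \<in> borel_measurable lborel"
    by (simp, intro borel_measurable_continuous_onI continuous_intros)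
  have "(LINT t|uniform_measure lborel {0..2*pi}. cis (of_int n * t))
      = (LINT t|density lborel (\<lambda>t. ennreal (indicator {0..2*pi} t / (2*pi))). cis (of_int n * t))"
  \<comment> \<open>\<open>integral_density\<close> wants a real-valued density, so the
    \<open>ennreal\<close> quotient in \<open>uniform_measure\<close> is rewritten first.\<close>
  proof -
    have "(\<lambda>t::real. indicator {0..2*pi} t / emeasure lborel {0..2*pi})
        = (\<lambda>t. ennreal (indicator {0..2*pi} t / (2*pi)))"
      by (auto simp: indicator_def divide_ennreal_def inverse_ennreal field_simps)
    then show ?thesis
      by (simp only: uniform_measure_def)
  qed
  also have "\<dots> = (LINT t|lborel. (indicator {0..2*pi} t / (2*pi)) *\<^sub>R cis (of_int n * t))"
    using m by (intro integral_density) auto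
  also have "\<dots> = (LINT t|lborel. indicator {0..2*pi} t *\<^sub>R (cis (of_int n * t) /\<^sub>R (2*pi)))"
    by (intro Bochner_Integration.integral_cong) (auto simp: field_simps)
  also have "\<dots> = (if n = 0 then 1 else 0)"
  proof (cases "n = 0")
    case True
    have "(LINT t|lborel. indicator {0..2*pi} t *\<^sub>R (cis (of_int n * t) /\<^sub>R (2*pi)))
       = complex_of_real (2*pi/(2*pi)) - complex_of_real (0/(2*pi))" unfolding True
      by (intro integral_FTC_atLeastAtMost)
         (auto intro!: derivative_eq_intros continuous_intros simp: has_vector_derivative_def field_simps scaleR_conv_of_real)
    then show ?thesis using True by simp
  next
    case False
    have "(LINT t|lborel. indicator {0..2*pi} t *\<^sub>R (cis (of_int n * t) /\<^sub>R (2*pi)))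
       = cis (of_int n * (2*pi)) / (of_int n * \<i>) /\<^sub>R (2*pi) - cis (of_int n * 0) / (of_int n * \<i>) /\<^sub>R (2*pi)"
      using False by (intro integral_FTC_atLeastAtMost)
         (auto intro!: derivative_eq_intros continuous_intros simp: has_vector_derivative_def field_simps scaleR_conv_of_real)
    moreover have "cis (of_int n * (2*pi)) = 1"
      using cis_multiple_2pi[of "of_int n"] by (simp add: mult.commute)
    ultimately show ?thesis using False by simp
  qed
  finally show ?thesis .
qed

lemma integral_circle_powi: "(LINT z|circle. z powi n) = (if n = 0 then 1 else 0)"
proof -
  have "(\<lambda>z::complex. z powi n) \<in> borel_measurable (restrict_space borel (sphere 0 1))"
    by (intro borel_measurable_continuous_on_restrict continuous_intros) auto
  then have "(LINT z|circle. z powi n) = (LINT t|uniform_measure lborel {0..2*pi}. cis t powi n)"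
    unfolding circle_def by (rule integral_distr[OF cis_measurable_sphere])
  then show ?thesis
    using integral_cis_of_int[of n] by (simp add: cis_power_int)
qed

section \<open>Borel sets of the circle and induction over bounded Borel functions\<close>

text \<open>Supplies an intersection-stable generator for the Dynkin argument. Since the circle is
  closed, traces of closed sets on it are closed.\<close>

lemma sets_circle_closed:
  "sets circle = sigma_sets (sphere 0 1) {C. closed C \<and> C \<subseteq> sphere 0 1}"
proof -
  have S: "sphere 0 1 \<in> sigma_sets UNIV (Collect closed :: complex set set)"
    by (intro sigma_sets.Basic) auto
  have "sets circle = (\<inter>) (sphere 0 1) ` sigma_sets UNIV (Collect closed)"
    by (simp add: sets_circle sets_restrict_space borel_eq_closed)
  also have "\<dots> = sigma_sets (sphere 0 1) ((\<inter>) (sphere 0 1) ` Collect closed)"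
    by (rule sigma_sets_Int[OF S]) simp
  also have "(\<inter>) (sphere 0 1) ` Collect closed = {C. closed C \<and> C \<subseteq> sphere (0::complex) 1}"
    by (auto simp: image_iff intro: closed_Int)
  finally show ?thesis .
qed

text \<open>
  Stone-Weierstrass reaches the continuous functions, bounded limits of these the indicators of
  closed sets, and a Dynkin argument all Borel indicators.
\<close>

lemma circle_bounded_induct [consumes 2, case_names monom lin lim]:
  assumes f: "f \<in> borel_measurable circle" and bf: "bounded (f ` sphere 0 1)"
    and monom: "\<And>n::int. P (\<lambda>z. z powi n)"
    and lin: "\<And>f g a b. f \<in> borel_measurable circle \<Longrightarrow> bounded (f ` sphere 0 1) \<Longrightarrow> P f \<Longrightarrow>
       g \<in> borel_measurable circle \<Longrightarrow> bounded (g ` sphere 0 1) \<Longrightarrow> P g \<Longrightarrow> P (\<lambda>z. a * f z + b * g z)"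
    and lim: "\<And>F f B. (\<And>n::nat. F n \<in> borel_measurable circle) \<Longrightarrow> f \<in> borel_measurable circle \<Longrightarrow>
       (\<And>n z. z \<in> sphere 0 1 \<Longrightarrow> cmod (F n z) \<le> B) \<Longrightarrow>
       (\<And>z. z \<in> sphere 0 1 \<Longrightarrow> (\<lambda>n. F n z) \<longlonglongrightarrow> f z) \<Longrightarrow> (\<And>n. P (F n)) \<Longrightarrow> P f"
  shows "P f"
proof -
  \<comment> \<open>Carrying measurability and boundedness along with \<open>P\<close> keeps the
    side conditions of \<open>lin\<close> and \<open>lim\<close> available at every stage.\<close>
  define Q where "Q f \<longleftrightarrow> f \<in> borel_measurable circle \<and> bounded (f ` sphere 0 1) \<and> P f" for f
  have Q_monom: "Q (\<lambda>z. z powi n)" for n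
    unfolding Q_def
    by (intro conjI continuous_imp_borel_circle continuous_intros compact_imp_bounded
          compact_continuous_image monom) auto
  have Q_lin: "Q (\<lambda>z. a * f z + b * g z)" if fg: "Q f" "Q g" for f g a b
  proof -
    have "f \<in> borel_measurable circle" "g \<in> borel_measurable circle"
      using fg by (auto simp: Q_def)
    moreover have "bounded ((\<lambda>z. a * f z + b * g z) ` sphere 0 1)"
    proof -
      obtain A B where "\<forall>z\<in>sphere 0 1. cmod (f z) \<le> A" "\<forall>z\<in>sphere 0 1. cmod (g z) \<le> B"
        using fg unfolding Q_def bounded_iff by (metis imageI)
      then have "cmod (a * f z + b * g z) \<le> cmod a * A + cmod b * B" if "z \<in> sphere 0 1" for z
        using that by (intro norm_triangle_le add_mono) (auto simp: norm_mult intro!: mult_left_mono)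
      then show ?thesis
        unfolding bounded_iff by blast
    qed
    moreover have "(\<lambda>z. a * f z + b * g z) \<in> borel_measurable circle"
      using calculation(1,2) by measurable
    ultimately show ?thesis
      using lin[of f g a b] fg unfolding Q_def by simp
  qed
  have Q_lim: "Q f" if "\<And>n::nat. Q (F n)" "f \<in> borel_measurable circle"
    "\<And>n z. z \<in> sphere 0 1 \<Longrightarrow> cmod (F n z) \<le> B"
    "\<And>z. z \<in> sphere 0 1 \<Longrightarrow> (\<lambda>n. F n z) \<longlonglongrightarrow> f z" for F f B
  proof -
    have "cmod (f z) \<le> B" if "z \<in> sphere 0 1" for z
      using \<open>\<And>z. z \<in> sphere 0 1 \<Longrightarrow> (\<lambda>n. F n z) \<longlonglongrightarrow> f z\<close>[OF that]
        \<open>\<And>n z. z \<in> sphere 0 1 \<Longrightarrow> cmod (F n z) \<le> B\<close>[OF that]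
      by (intro tendsto_upperbound[OF tendsto_norm]) auto
    then have "bounded (f ` sphere 0 1)"
      by (intro boundedI[of _ B]) auto
    moreover have "P f"
      using that by (intro lim[of F f B]) (auto simp: Q_def)
    ultimately show ?thesis
      using that(2) by (simp add: Q_def)
  qed
  \<comment> \<open>Nothing is assumed about how \<open>P\<close> treats values off the circle; a
    constant sequence in \<open>lim\<close> shows that they do not matter.\<close>
  have Q_cong: "Q g" if fg: "Q f" "\<And>z. z \<in> sphere 0 1 \<Longrightarrow> f z = g z" for f g
  proof -
    have "f \<in> borel_measurable circle"
      using fg by (auto simp: Q_def)
    then have "g \<in> borel_measurable circle"
      using fg(2) by (subst measurable_cong[where g=f]) auto
    moreover obtain B where "\<forall>z\<in>sphere 0 1. cmod (f z) \<le> B"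
      using fg unfolding Q_def bounded_iff by auto
    ultimately show ?thesis
      using fg by (intro Q_lim[of "\<lambda>_. f" g B]) auto
  qed
  have Q_const: "Q (\<lambda>z. c)" for c
    using Q_lin[of "\<lambda>z. z powi 0" "\<lambda>z. z powi 0" c 0] Q_monom[of 0] by simp
  have Q_add: "Q (\<lambda>z. f z + g z)" if "Q f" "Q g" for f g
    using Q_lin[of f g 1 1] that by simp
  have Q_cmult: "Q (\<lambda>z. c * f z)" if "Q f" for f c
    using Q_lin[of f f c 0] that by simp
  have Q_diff: "Q (\<lambda>z. f z - g z)" if "Q f" "Q g" for f g
    using Q_lin[of f g 1 "-1"] that by simp
  have Q_sum: "Q (\<lambda>z. \<Sum>i\<in>I. f i z)" if "finite I" "\<And>i. i \<in> I \<Longrightarrow> Q (f i)" for I :: "complex set" and f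
    using that by (induction I) (auto intro: Q_const Q_add)

  \<comment> \<open>Stability under all monomial factors is what the induction over polynomials
    preserves: a linear form shifts exponents by one, and a product is treated by applying the
    induction hypothesis for one factor to the result of the other.\<close>
  define R where "R g \<longleftrightarrow> (\<forall>n::int. Q (\<lambda>z. g z * z powi n))" for g
  have real_poly: "R g \<Longrightarrow> R (\<lambda>z. of_real (p z) * g z)" if "real_polynomial_function p" for p g
    using that
  proof (induction p arbitrary: g)
    case (linear p)
    interpret bounded_linear p by fact
    \<comment> \<open>On the circle \<open>inverse z = cnj z\<close>, so
      \<open>Re z = (z + 1/z) / 2\<close> and \<open>Im z = - \<i> * (z - 1/z) / 2\<close>.
      Collecting terms turns the real-linear form \<open>p\<close> into
      \<open>c * z + d / z\<close>.\<close>
    define c d where "c = (of_real (p 1) - \<i> * of_real (p \<i>)) / 2"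
      and "d = (of_real (p 1) + \<i> * of_real (p \<i>)) / 2"
    have p: "of_real (p z) * g z * z powi n = c * (g z * z powi (n + 1)) + d * (g z * z powi (n - 1))"
      if "z \<in> sphere 0 1" for z n
    proof -
      have "p z = p (Re z *\<^sub>R 1 + Im z *\<^sub>R \<i>)"
        by (rule arg_cong[of _ _ p]) (simp add: complex_eq_iff)
      then have pz: "p z = Re z * p 1 + Im z * p \<i>"
        by (simp only: add scaleR real_scaleR_def)
      define w where "w = inverse z"
      have "inverse z = cnj z"
        using that by (intro inverse_unique) (simp flip: complex_norm_square)
      then have "complex_of_real (Re z) = (z + w) / 2" "complex_of_real (Im z) = - \<i> * (z - w) / 2"
        by (simp_all add: w_def complex_eq_iff)
      then have "of_real (p z) = (z + w) / 2 * of_real (p 1) + - \<i> * (z - w) / 2 * of_real (p \<i>)"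
        by (simp only: pz of_real_add of_real_mult)
      also have "\<dots> = c * z + d * w"
        by (simp add: c_def d_def field_simps)
      finally have "of_real (p z) = c * z + d * inverse z"
        by (simp add: w_def)
      moreover have "z \<noteq> 0"
        using that by auto
      then have "z powi (n + 1) = z powi n * z" "z powi (n - 1) = z powi n * inverse z"
        by (simp_all add: power_int_add power_int_diff divide_inverse)
      ultimately show ?thesis
        by (simp add: algebra_simps)
    qed
    show ?case
      unfolding R_def
    proof
      fix n
      have "Q (\<lambda>z. c * (g z * z powi (n + 1)) + d * (g z * z powi (n - 1)))"
        using linear.prems unfolding R_def by (intro Q_lin) auto
      then show "Q (\<lambda>z. of_real (p z) * g z * z powi n)"
        by (rule Q_cong) (use p in auto)
    qed
  next
    case (const c)
    then show ?case
      by (auto simp: R_def mult.assoc intro: Q_cmult)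
  next
    case (add p q)
    then show ?case
      by (auto simp: R_def algebra_simps intro: Q_add)
  next
    case (mult p q)
    then show ?case
      by (metis (no_types, lifting) ext mult.assoc of_real_mult)
  qed
  have Q_real_poly: "Q (\<lambda>z. of_real (p z))" if "real_polynomial_function p" for p
  proof -
    have "R (\<lambda>z. 1)"
      using Q_monom by (simp add: R_def)
    from real_poly[OF that this] show ?thesis
      unfolding R_def by (auto dest: spec[of _ 0])
  qed
  have Q_continuous: "Q (\<lambda>z. of_real (h z))" if h: "continuous_on (sphere 0 1) h" for h :: "complex \<Rightarrow> real"
  proof -
    have "\<exists>g. polynomial_function g \<and> (\<forall>x\<in>sphere 0 1. norm (h x - g x) < 1 / Suc n)" for n
      by (intro Stone_Weierstrass_polynomial_function h) auto
    then obtain g where g: "\<And>n. polynomial_function (g n)"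
      "\<And>n z. z \<in> sphere 0 1 \<Longrightarrow> \<bar>h z - g n z\<bar> < 1 / Suc n"
      by (metis real_norm_def)
    have "bounded (h ` sphere 0 1)"
      using compact_imp_bounded[OF compact_continuous_image[OF h]] by simp
    then obtain B where "\<forall>z\<in>sphere 0 1. \<bar>h z\<bar> \<le> B"
      unfolding bounded_iff by auto
    then have B: "\<bar>h z\<bar> \<le> B" if "z \<in> sphere 0 1" for z
      using that by blast
    show ?thesis
    proof (rule Q_lim)
      show "Q (\<lambda>z. of_real (g n z))" for n
        using g(1)[of n] by (intro Q_real_poly) (simp add: real_polynomial_function_eq)
      show "(\<lambda>z. complex_of_real (h z)) \<in> borel_measurable circle"
        by (intro continuous_imp_borel_circle continuous_intros h)
      show "cmod (of_real (g n z)) \<le> B + 1" if "z \<in> sphere 0 1" for n z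
      proof -
        have "1 / real (Suc n) \<le> 1" by simp
        then show ?thesis
          using g(2)[OF that, of n] B[OF that] by (simp only: norm_of_real)
      qed
      show "(\<lambda>n. complex_of_real (g n z)) \<longlonglongrightarrow> of_real (h z)" if "z \<in> sphere 0 1" for z
      proof -
        have "(\<lambda>n. g n z - h z) \<longlonglongrightarrow> 0"
          by (rule Lim_null_comparison[OF _ LIMSEQ_Suc[OF lim_1_over_n]])
            (use g(2)[OF that] in \<open>auto simp: abs_minus_commute intro!: always_eventually less_imp_le\<close>)
        then show ?thesis
          by (auto intro!: tendsto_of_real simp: LIM_zero_iff)
      qed
    qed
  qed
  have Q_closed: "Q (indicator C)" if C: "closed C" "C \<subseteq> sphere 0 1" for C
  proof (cases "C = {}")
    \<comment> \<open>The empty set is separate because \<open>infdist\<close> to it is 0 by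
      convention, which would make the functions below constantly 1.\<close>
    case True
    show ?thesis by (rule Q_cong[OF Q_const[of 0]]) (simp add: True)
  next
    case False
    have "C \<in> sets circle"
      using that by (auto simp: sets_circle_closed)
    \<comment> \<open>Continuous tents: equal to 1 on \<open>C\<close>, and zero at a point at
      distance \<open>r > 0\<close> as soon as \<open>n \<ge> 1 / r\<close>. Closedness of
      \<open>C\<close> gives positive distance off \<open>C\<close>.\<close>
    define h where "h n z = max 0 (1 - real n * infdist z C)" for n z
    show ?thesis
    proof (rule Q_lim)
      show "Q (\<lambda>z. of_real (h n z))" for n
        unfolding h_def by (intro Q_continuous continuous_intros)
      show "indicator C \<in> borel_measurable circle"
        using \<open>C \<in> sets circle\<close> by simp
      show "cmod (of_real (h n z)) \<le> 1" for n z
        by (simp add: h_def infdist_nonneg)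
      show "(\<lambda>n. complex_of_real (h n z)) \<longlonglongrightarrow> indicator C z" for z
      proof (cases "z \<in> C")
        case True
        then show ?thesis by (simp add: h_def)
      next
        case z: False
        have pos: "infdist z C > 0"
          using C False z by (intro infdist_pos_not_in_closed) auto
        obtain N where N: "1 / infdist z C < real N"
          using reals_Archimedean2 by blast
        have "h n z = 0" if "n \<ge> N" for n
        proof -
          have "1 \<le> real n * infdist z C"
            using N that pos by (simp add: field_simps) (smt (verit) mult_right_mono of_nat_le_iff)
          then show ?thesis by (simp add: h_def)
        qed
        then have "eventually (\<lambda>n. complex_of_real (h n z) = indicator C z) sequentially"
          using z by (auto simp: eventually_sequentially)
        then show ?thesis
          by (rule tendsto_eventually)
      qed
    qed
  qed
  have Q_set: "Q (indicator A)" if "A \<in> sets circle" for A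
  proof -
    have "Int_stable {C. closed C \<and> C \<subseteq> sphere (0::complex) 1}"
      by (auto simp: Int_stable_def)
    moreover have "{C. closed C \<and> C \<subseteq> sphere (0::complex) 1} \<subseteq> Pow (sphere 0 1)"
      by auto
    moreover have "A \<in> sigma_sets (sphere 0 1) {C. closed C \<and> C \<subseteq> sphere 0 1}"
      using that by (simp add: sets_circle_closed)
    ultimately show ?thesis
    proof (induction rule: sigma_sets_induct_disjoint)
      case (basic A)
      then show ?case using Q_closed by auto
    next
      case empty
      show ?case by (rule Q_cong[OF Q_const[of 0]]) simp
    next
      case (compl A)
      have "Q (\<lambda>z. 1 - indicator A z)"
        by (intro Q_diff Q_const compl)
      then show ?case
        by (rule Q_cong) (auto simp: indicator_def)
    next
      case (union A)
      \<comment> \<open>Disjointness makes the indicator of a finite union a sum, so linearity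
        covers the finite stages and \<open>Q_lim\<close> the countable union.\<close>
      have "Q (indicator (\<Union>i<n. A i))" for n
      proof (induction n)
        case 0
        show ?case by (rule Q_cong[OF Q_const[of 0]]) simp
      next
        case (Suc n)
        have disj: "A i \<inter> A n = {}" if "i < n" for i
          using disjoint_family_onD[OF union(1), of i n] that by simp
        have "Q (\<lambda>z. indicator (\<Union>i<n. A i) z + indicator (A n) z)"
          using Suc union(3) by (rule Q_add)
        then show ?case
        proof (rule Q_cong)
          fix z :: complex
          have "(\<Union>i<Suc n. A i) = (\<Union>i<n. A i) \<union> A n"
            by (auto simp: less_Suc_eq)
          moreover have "z \<notin> A n" if "z \<in> (\<Union>i<n. A i)"
            using disj that by blast
          ultimately show "indicator (\<Union>i<n. A i) z + indicator (A n) z = (indicator (\<Union>i<Suc n. A i) z :: complex)"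
            by (auto simp: indicator_def)
        qed
      qed
      then show ?case
      proof (rule Q_lim)
        have "(\<Union>i. A i) \<in> sets circle"
          using union(2) unfolding sets_circle_closed by (intro sigma_sets.Union) (rule subsetD, auto)
        then show "indicator (\<Union>i. A i) \<in> borel_measurable circle"
          by (rule borel_measurable_indicator)
        show "cmod (indicator (\<Union>i<n. A i) z) \<le> 1" for n z
          by (simp add: indicator_def)
      qed (rule LIMSEQ_indicator_UN)
    qed
  qed
  \<comment> \<open>These simple functions are dominated by \<open>2 * cmod (f z)\<close>, so a
    bound for \<open>f\<close> yields the uniform bound that \<open>Q_lim\<close> requires.\<close>
  obtain F where F: "\<And>i. simple_function circle (F i)"
    "\<And>z. z \<in> sphere 0 1 \<Longrightarrow> (\<lambda>i. F i z) \<longlonglongrightarrow> f z"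
    "\<And>i z. z \<in> sphere 0 1 \<Longrightarrow> cmod (F i z) \<le> 2 * cmod (f z)"
    using borel_measurable_implies_sequence_metric[OF f, of 0]
    unfolding space_circle dist_norm diff_zero by blast
  have "Q (F i)" for i
  proof -
    have fin: "finite (F i ` sphere 0 1)"
      using simple_functionD(1)[OF F(1)] by simp
    have "Q (indicator (F i -` {y} \<inter> sphere 0 1))" for y
      using simple_functionD(2)[OF F(1)[of i], of "{y}"] by (intro Q_set) simp
    \<comment> \<open>A simple function is a finite combination of the indicators of its level
      sets.\<close>
    then have "Q (\<lambda>z. \<Sum>y\<in>F i ` sphere 0 1. y * indicator (F i -` {y} \<inter> sphere 0 1) z)"
      by (intro Q_sum Q_cmult fin)
    then show ?thesis
    proof (rule Q_cong)
      fix z :: complex assume z: "z \<in> sphere 0 1"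
      have "(\<Sum>y\<in>F i ` sphere 0 1. y * indicator (F i -` {y} \<inter> sphere 0 1) z)
          = (\<Sum>y\<in>F i ` sphere 0 1. if y = F i z then y else 0)"
        using z by (intro sum.cong) (auto simp: indicator_def)
      also have "\<dots> = F i z"
        using z fin by (subst sum.delta) auto
      finally show "(\<Sum>y\<in>F i ` sphere 0 1. y * indicator (F i -` {y} \<inter> sphere 0 1) z) = F i z" .
    qed
  qed
  moreover obtain B where B: "\<forall>z\<in>sphere 0 1. cmod (f z) \<le> B"
    using bf unfolding bounded_iff by auto
  moreover have "cmod (F i z) \<le> 2 * B" if "z \<in> sphere 0 1" for i z
    using F(3)[OF that, of i] bspec[OF B that] by linarith
  ultimately have "Q f"
    using F f by (intro Q_lim[of F f "2 * B"])
  then show "P f"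
    by (simp add: Q_def)
qed

section \<open>Fourier coefficients determine arc length; its invariance under rotations and
  powers\<close>

text \<open>Both integrals agree on monomials and respect linear combinations and bounded limits.
  Bounded induction therefore makes them agree on all bounded Borel functions, in particular on
  indicators.\<close>

lemma circle_measure_eqI:
  assumes M: "finite_measure M" "sets M = sets circle"
    and eq: "\<And>n::int. (LINT z|M. z powi n) = (if n = 0 then 1 else 0)"
  shows "M = circle"
proof (rule measure_eqI)
  fix A assume "A \<in> sets M"
  interpret M: finite_measure M by fact
  have sp: "space M = sphere 0 1"
    using sets_eq_imp_space_eq[OF M(2)] by simp
  have meas: "f \<in> borel_measurable M" if "f \<in> borel_measurable circle" for f :: "complex \<Rightarrow> complex"
    using that M(2) by (simp cong: measurable_cong_sets)
  have int: "integrable M f" "integrable circle f"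
    if f: "f \<in> borel_measurable circle" "bounded (f ` sphere 0 1)" for f :: "complex \<Rightarrow> complex"
  proof -
    obtain B where "\<forall>z\<in>sphere 0 1. cmod (f z) \<le> B"
      using f(2) unfolding bounded_iff by auto
    then have "AE z in M. cmod (f z) \<le> B" "AE z in circle. cmod (f z) \<le> B"
      by (intro AE_I2; simp add: sp)+
    then show "integrable M f" "integrable circle f"
      using f(1) meas[OF f(1)] by (blast intro: M.integrable_const_bound circle.integrable_const_bound)+
  qed
  have A: "A \<in> sets circle" using \<open>A \<in> sets M\<close> M by simp
  have "(LINT z|M. f z) = (LINT z|circle. f z)"
    if "f \<in> borel_measurable circle" "bounded (f ` sphere 0 1)" for f :: "complex \<Rightarrow> complex"
    using that
  proof (induction rule: circle_bounded_induct)
    case (monom n)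
    show ?case by (simp add: eq integral_circle_powi)
  next
    case (lin f g a b)
    then show ?case by (simp add: int)
  next
    case (lim F f B)
    have "(\<lambda>n. LINT z|M. F n z) \<longlonglongrightarrow> (LINT z|M. f z)"
    proof (rule integral_dominated_convergence[where w="\<lambda>_. B"])
      show "AE z in M. (\<lambda>n. F n z) \<longlonglongrightarrow> f z" "\<And>n. AE z in M. norm (F n z) \<le> B"
        using lim(3,4) sp by (intro AE_I2; simp)+
    qed (simp_all add: lim(1,2) meas)
    moreover have "(\<lambda>n. LINT z|circle. F n z) \<longlonglongrightarrow> (LINT z|circle. f z)"
    proof (rule integral_dominated_convergence[where w="\<lambda>_. B"])
      show "AE z in circle. (\<lambda>n. F n z) \<longlonglongrightarrow> f z" "\<And>n. AE z in circle. norm (F n z) \<le> B"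
        using lim(3,4) by (intro AE_I2; simp)+
    qed (simp_all add: lim(1,2))
    ultimately show ?case
      using LIMSEQ_unique by (simp add: lim(5))
  qed
  moreover have "bounded ((\<lambda>z. complex_of_real (indicator A z)) ` sphere 0 1)"
    by (intro boundedI[of _ 1]) (auto simp: indicator_def)
  moreover have "(\<lambda>z. complex_of_real (indicator A z)) \<in> borel_measurable circle"
    using A by measurable
  ultimately have "(LINT z|M. complex_of_real (indicator A z)) = (LINT z|circle. complex_of_real (indicator A z))"
    by blast
  then have "measure M A = measure circle A"
    using sets.sets_into_space[OF A] sp by (simp only: integral_complex_of_real) (simp add: Int_absorb2)
  then show "emeasure M A = emeasure circle A"
    by (simp add: M.emeasure_eq_measure circle.emeasure_eq_measure)
qed fact

text \<open>Reduces invariance of arc length under \<open>T\<close> to a computation of Fourier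
  coefficients.\<close>

lemma circle_distr_eqI:
  assumes T: "T \<in> circle \<rightarrow>\<^sub>M circle"
    and eq: "\<And>n::int. (LINT z|circle. T z powi n) = (if n = 0 then 1 else 0)"
  shows "distr circle circle T = circle"
proof (rule circle_measure_eqI)
  show "finite_measure (distr circle circle T)"
    using circle.prob_space_distr[OF T] by (simp add: prob_space_def)
  show "(LINT z|distr circle circle T. z powi n) = (if n = 0 then 1 else 0)" for n
  proof -
    have "(\<lambda>z::complex. z powi n) \<in> borel_measurable circle"
      by (intro continuous_imp_borel_circle continuous_intros) auto
    then show ?thesis
      by (simp add: integral_distr[OF T] eq)
  qed
qed simp

lemma circle_rotate_measurable:
  assumes "cmod c = 1"
  shows "(\<lambda>z. c * z) \<in> circle \<rightarrow>\<^sub>M circle"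
  using assms
  by (auto simp: measurable_circle_iff norm_mult intro!: continuous_imp_borel_circle continuous_intros)

lemma circle_power_measurable: "(\<lambda>z. z ^ k) \<in> circle \<rightarrow>\<^sub>M circle"
  by (auto simp: measurable_circle_iff norm_power intro!: continuous_imp_borel_circle continuous_intros)

text \<open>Rotation multiplies the coefficient of index \<open>n\<close> by
  \<open>c powi n\<close>, which is 1 at \<open>n = 0\<close>, the only index with a nonzero
  coefficient.\<close>

lemma distr_circle_rotate:
  assumes "cmod c = 1"
  shows "distr circle circle (\<lambda>z. c * z) = circle"
  using assms
  by (intro circle_distr_eqI circle_rotate_measurable)
    (auto simp: power_int_mult_distrib integral_circle_powi)

text \<open>The power map turns index \<open>n\<close> into \<open>int k * n\<close>, which for
  \<open>k \<ge> 1\<close> vanishes exactly when \<open>n\<close> does.\<close>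

lemma distr_circle_power:
  assumes "k \<ge> 1"
  shows "distr circle circle (\<lambda>z. z ^ k) = circle"
proof (intro circle_distr_eqI circle_power_measurable)
  fix n :: int
  have "(\<lambda>z::complex. (z ^ k) powi n) = (\<lambda>z. z powi (int k * n))"
    by (simp add: power_int_mult)
  then show "(LINT z|circle. (z ^ k) powi n) = (if n = 0 then 1 else 0)"
    using assms by (simp add: integral_circle_powi)
qed

section \<open>The space of square integrable functions\<close>

lemma L2_I [intro?]:
  "f \<in> borel_measurable circle \<Longrightarrow> integrable circle (\<lambda>z. (cmod (f z))\<^sup>2) \<Longrightarrow> f \<in> L2"
  by (simp add: L2_def)

lemma L2_measurable [measurable_dest]: "f \<in> L2 \<Longrightarrow> f \<in> borel_measurable circle"
  by (simp add: L2_def)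

lemma L2_square_integrable: "f \<in> L2 \<Longrightarrow> integrable circle (\<lambda>z. (cmod (f z))\<^sup>2)"
  by (simp add: L2_def)

lemma L2_dominated:
  assumes f: "f \<in> borel_measurable circle" and g: "g \<in> L2"
    and le: "AE z in circle. cmod (f z) \<le> C * cmod (g z)"
  shows "f \<in> L2"
proof
  show "integrable circle (\<lambda>z. (cmod (f z))\<^sup>2)"
  proof (rule Bochner_Integration.integrable_bound)
    show "integrable circle (\<lambda>z. C\<^sup>2 * (cmod (g z))\<^sup>2)"
      using L2_square_integrable[OF g] by simp
    show "AE z in circle. norm ((cmod (f z))\<^sup>2) \<le> norm (C\<^sup>2 * (cmod (g z))\<^sup>2)"
      using le
    proof eventually_elim
      case (elim z)
      from power_mono[OF this, of 2] show ?case by (simp add: power_mult_distrib)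
    qed
  qed (use f in measurable)
qed fact

lemma L2_bounded:
  assumes "f \<in> borel_measurable circle" "AE z in circle. cmod (f z) \<le> B"
  shows "f \<in> L2"
proof (rule L2_dominated)
  show "(\<lambda>z. 1) \<in> L2" by (simp add: L2_def)
  show "AE z in circle. cmod (f z) \<le> B * cmod 1" using assms by simp
qed fact

lemma L2_bounded_sphere:
  assumes "f \<in> borel_measurable circle" "\<And>z. z \<in> sphere 0 1 \<Longrightarrow> cmod (f z) \<le> B"
  shows "f \<in> L2"
  using assms(1)
proof (rule L2_bounded)
  show "AE z in circle. cmod (f z) \<le> B"
    by (rule AE_I2) (simp add: assms(2))
qed

lemma L2_continuous:
  assumes "continuous_on (sphere 0 1) f"
  shows "f \<in> L2"
proof -
  obtain B where B: "\<forall>z\<in>sphere 0 1. cmod (f z) \<le> B"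
    using compact_imp_bounded[OF compact_continuous_image[OF assms]] unfolding bounded_iff by auto
  show ?thesis
    by (rule L2_bounded_sphere[OF continuous_imp_borel_circle[OF assms] bspec[OF B]])
qed

lemma L2_powi: "(\<lambda>z. z powi n) \<in> L2"
  by (intro L2_continuous continuous_intros) auto

lemma L2_mult_bounded:
  assumes f: "f \<in> L2" and g: "g \<in> borel_measurable circle" "AE z in circle. cmod (g z) \<le> B"
  shows "(\<lambda>z. g z * f z) \<in> L2"
proof (rule L2_dominated)
  note [measurable] = f g(1)
  show "(\<lambda>z. g z * f z) \<in> borel_measurable circle" by measurable
  show "AE z in circle. cmod (g z * f z) \<le> B * cmod (f z)"
    using g(2) by eventually_elim (simp add: norm_mult mult_right_mono)
qed fact

lemma L2_lin:
  assumes f: "f \<in> L2" and g: "g \<in> L2"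
  shows "(\<lambda>z. a * f z + b * g z) \<in> L2"
proof
  note [measurable] = f g
  show "(\<lambda>z. a * f z + b * g z) \<in> borel_measurable circle" by measurable
  show "integrable circle (\<lambda>z. (cmod (a * f z + b * g z))\<^sup>2)"
  proof (rule Bochner_Integration.integrable_bound)
    show "integrable circle (\<lambda>z. 2 * (cmod a)\<^sup>2 * (cmod (f z))\<^sup>2 + 2 * (cmod b)\<^sup>2 * (cmod (g z))\<^sup>2)"
      using L2_square_integrable[OF f] L2_square_integrable[OF g] by simp
    have "(cmod (x + y))\<^sup>2 \<le> 2 * (cmod x)\<^sup>2 + 2 * (cmod y)\<^sup>2" for x y :: complex
    proof -
      have "(cmod (x + y))\<^sup>2 \<le> (cmod x + cmod y)\<^sup>2"
        by (intro power_mono norm_triangle_ineq) auto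
      also have "\<dots> \<le> 2 * (cmod x)\<^sup>2 + 2 * (cmod y)\<^sup>2"
        using zero_le_power2[of "cmod x - cmod y"] by (simp add: power2_eq_square algebra_simps)
      finally show ?thesis .
    qed
    from this[of "a * f z" "b * g z" for z]
    show "AE z in circle. norm ((cmod (a * f z + b * g z))\<^sup>2)
        \<le> norm (2 * (cmod a)\<^sup>2 * (cmod (f z))\<^sup>2 + 2 * (cmod b)\<^sup>2 * (cmod (g z))\<^sup>2)"
      by (simp add: norm_mult power_mult_distrib mult.assoc)
  qed measurable
qed

lemma L2_add: "f \<in> L2 \<Longrightarrow> g \<in> L2 \<Longrightarrow> (\<lambda>z. f z + g z) \<in> L2"
  using L2_lin[of f g 1 1] by simp

lemma L2_diff: "f \<in> L2 \<Longrightarrow> g \<in> L2 \<Longrightarrow> (\<lambda>z. f z - g z) \<in> L2"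
  using L2_lin[of f g 1 "-1"] by simp

lemma L2_cnj_fun: "f \<in> L2 \<Longrightarrow> (\<lambda>z. cnj (f z)) \<in> L2"
  using borel_measurable_continuous_on[of cnj f circle]
  by (auto simp: L2_def continuous_on_cnj)

lemma L2_mult_integrable:
  assumes f: "f \<in> L2" and g: "g \<in> L2"
  shows "integrable circle (\<lambda>z. f z * g z)"
proof (rule Bochner_Integration.integrable_bound)
  note [measurable] = f g
  show "integrable circle (\<lambda>z. (cmod (f z))\<^sup>2 + (cmod (g z))\<^sup>2)"
    using L2_square_integrable[OF f] L2_square_integrable[OF g] by simp
  have "x * y \<le> x\<^sup>2 + y\<^sup>2" if "x \<ge> 0" "y \<ge> 0" for x y :: real
    using zero_le_power2[of "x - y"] mult_nonneg_nonneg[OF that]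
    by (simp add: power2_eq_square algebra_simps)
  then show "AE z in circle. norm (f z * g z) \<le> norm ((cmod (f z))\<^sup>2 + (cmod (g z))\<^sup>2)"
    by (simp add: norm_mult)
  show "(\<lambda>z. f z * g z) \<in> borel_measurable circle" by measurable
qed

lemma L2_inner_integrable:
  "f \<in> L2 \<Longrightarrow> g \<in> L2 \<Longrightarrow> integrable circle (\<lambda>z. f z * cnj (g z))"
  by (intro L2_mult_integrable L2_cnj_fun)

lemma L2_inner_lin:
  assumes "f \<in> L2" "g \<in> L2" "h \<in> L2"
  shows "L2_inner (\<lambda>z. a * f z + b * g z) h = a * L2_inner f h + b * L2_inner g h"
  using assms L2_inner_integrable[of f h] L2_inner_integrable[of g h]
  by (simp add: L2_inner_def distrib_right mult.assoc)

lemma L2_inner_commute: "L2_inner g f = cnj (L2_inner f g)"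
  unfolding L2_inner_def by (subst Bochner_Integration.integral_cnj[symmetric]) (simp add: mult.commute)

lemma L2_inner_cong_AE:
  assumes "f \<in> L2" "f' \<in> L2" "g \<in> L2" "g' \<in> L2"
    and "AE z in circle. f z = f' z" "AE z in circle. g z = g' z"
  shows "L2_inner f g = L2_inner f' g'"
  unfolding L2_inner_def
proof (rule integral_cong_AE)
  show "AE z in circle. f z * cnj (g z) = f' z * cnj (g' z)"
    using assms(5,6) by eventually_elim simp
qed (use assms in \<open>auto intro!: borel_measurable_integrable L2_inner_integrable\<close>)

lemma L2_inner_self: "L2_inner f f = of_real ((L2_norm f)\<^sup>2)"
  by (simp add: L2_inner_def L2_norm_def complex_mult_cnj cmod_power2[symmetric] flip: of_real_power
      integral_complex_of_real)

lemma L2_norm_eq_0_iff: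
  assumes "f \<in> L2"
  shows "L2_norm f = 0 \<longleftrightarrow> (AE z in circle. f z = 0)"
  unfolding L2_norm_def
  using integral_nonneg_eq_0_iff_AE[OF L2_square_integrable[OF assms]] by simp

lemma L2_norm_nonneg: "L2_norm f \<ge> 0"
  by (simp add: L2_norm_def)

text \<open>A weighted arithmetic-geometric mean inequality is integrated pointwise. The weight
  needs both norms positive; if one is zero, that function vanishes almost everywhere.\<close>

lemma L2_Cauchy_Schwarz:
  assumes f: "f \<in> L2" and g: "g \<in> L2"
  shows "cmod (L2_inner f g) \<le> L2_norm f * L2_norm g"
proof -
  consider "L2_norm f = 0" | "L2_norm g = 0" | "L2_norm f > 0" "L2_norm g > 0"
    using L2_norm_nonneg[of f] L2_norm_nonneg[of g] by linarith
  then show ?thesis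
  proof cases
    case 1
    then have "AE z in circle. f z = 0" using L2_norm_eq_0_iff[OF f] by simp
    then have "L2_inner f g = 0"
      unfolding L2_inner_def by (intro integral_eq_zero_AE) (auto elim: eventually_mono)
    then show ?thesis using 1 by simp
  next
    case 2
    then have "AE z in circle. g z = 0" using L2_norm_eq_0_iff[OF g] by simp
    then have "L2_inner f g = 0"
      unfolding L2_inner_def by (intro integral_eq_zero_AE) (auto elim: eventually_mono)
    then show ?thesis using 2 by simp
  next
    case 3
    \<comment> \<open>This ratio minimises \<open>(t * A + B / t) / 2\<close>, where
      \<open>A\<close> and \<open>B\<close> are the squared norms of \<open>f\<close> and
      \<open>g\<close>; the minimum is the product of the norms.\<close>
    define t where "t = L2_norm g / L2_norm f"
    have t: "t > 0" using 3 by (simp add: t_def)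
    have le: "cmod (f z * cnj (g z)) \<le> (t * (cmod (f z))\<^sup>2 + (cmod (g z))\<^sup>2 / t) / 2" for z
    proof -
      have "2 * (cmod (f z) * cmod (g z)) * t \<le> t * t * (cmod (f z))\<^sup>2 + (cmod (g z))\<^sup>2"
        using zero_le_power2[of "t * cmod (f z) - cmod (g z)"] by (simp add: power2_eq_square algebra_simps)
      then show ?thesis
        using t by (simp add: norm_mult field_simps)
    qed
    have "cmod (L2_inner f g) \<le> (LINT z|circle. (t * (cmod (f z))\<^sup>2 + (cmod (g z))\<^sup>2 / t) / 2)"
      unfolding L2_inner_def
      by (rule Bochner_Integration.integral_norm_bound_integral)
        (simp_all only: le L2_inner_integrable[OF f g],
          simp add: L2_square_integrable[OF f] L2_square_integrable[OF g])
    also have "\<dots> = (t * (L2_norm f)\<^sup>2 + (L2_norm g)\<^sup>2 / t) / 2"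
      using L2_square_integrable[OF f] L2_square_integrable[OF g] by (simp add: L2_norm_def)
    also have "\<dots> = L2_norm f * L2_norm g"
      using 3 by (simp add: t_def field_simps power2_eq_square)
    finally show ?thesis .
  qed
qed

lemma L2_norm_tendsto_0:
  assumes "\<And>n::nat. F n \<in> borel_measurable circle" "f \<in> borel_measurable circle"
    and "integrable circle w"
    and "AE z in circle. (\<lambda>n. F n z) \<longlonglongrightarrow> f z"
    and "\<And>n. AE z in circle. (cmod (F n z - f z))\<^sup>2 \<le> w z"
  shows "(\<lambda>n. L2_norm (\<lambda>z. F n z - f z)) \<longlonglongrightarrow> 0"
proof -
  note [measurable] = assms(1,2)
  have "(\<lambda>n. LINT z|circle. (cmod (F n z - f z))\<^sup>2) \<longlonglongrightarrow> (LINT z|circle. 0)"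
  proof (rule integral_dominated_convergence[where w=w])
    show "AE z in circle. (\<lambda>n. (cmod (F n z - f z))\<^sup>2) \<longlonglongrightarrow> 0"
      using assms(4)
    proof eventually_elim
      case (elim z)
      then have "(\<lambda>n. (cmod (F n z - f z))\<^sup>2) \<longlonglongrightarrow> (cmod (f z - f z))\<^sup>2"
        by (intro tendsto_intros)
      then show ?case by simp
    qed
  qed (use assms in auto)
  from tendsto_real_sqrt[OF this] show ?thesis
    by (simp add: L2_norm_def)
qed

text \<open>Density of trigonometric polynomials in the form of a uniqueness principle. Bounded
  induction leads from monomials to bounded functions, truncation from these to all of
  \<open>L2\<close>.\<close>

lemma L2_functional_eq_0:
  assumes lin: "\<And>f g a b. f \<in> L2 \<Longrightarrow> g \<in> L2 \<Longrightarrow> \<Lambda> (\<lambda>z. a * f z + b * g z) = a * \<Lambda> f + b * \<Lambda> g"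
    and bdd: "\<And>f. f \<in> L2 \<Longrightarrow> cmod (\<Lambda> f) \<le> C * L2_norm f"
    and monom: "\<And>n::int. \<Lambda> (\<lambda>z. z powi n) = 0"
    and f: "f \<in> L2"
  shows "\<Lambda> f = 0"
proof -
  \<comment> \<open>The kernel is closed in norm: by linearity \<open>\<Lambda>\<close> takes the
    value \<open>- \<Lambda> f\<close> at \<open>F n - f\<close>, whose norm tends to 0.\<close>
  have lim: "\<Lambda> f = 0" if "\<And>n::nat. F n \<in> L2" "f \<in> L2" "(\<lambda>n. L2_norm (\<lambda>z. F n z - f z)) \<longlonglongrightarrow> 0"
    "\<And>n. \<Lambda> (F n) = 0" for F f
  proof -
    have "cmod (\<Lambda> f) \<le> C * L2_norm (\<lambda>z. F n z - f z)" for n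
    proof -
      have "\<Lambda> (\<lambda>z. F n z - f z) = - \<Lambda> f"
        using lin[of "F n" f 1 "-1"] that by simp
      then show ?thesis
        using bdd[OF L2_diff[of "F n" f]] that by simp
    qed
    moreover have "(\<lambda>n. C * L2_norm (\<lambda>z. F n z - f z)) \<longlonglongrightarrow> C * 0"
      by (intro tendsto_intros that)
    ultimately have "cmod (\<Lambda> f) \<le> C * 0"
      by (intro tendsto_lowerbound[of _ "C * 0" sequentially]) auto
    then show ?thesis by simp
  qed
  note limI = this
  have bounded: "\<Lambda> f = 0" if "f \<in> borel_measurable circle" "bounded (f ` sphere 0 1)" for f
    using that
  proof (induction rule: circle_bounded_induct)
    case (lin f g a b)
    have "h \<in> L2" if h: "h \<in> borel_measurable circle" and b: "bounded (h ` sphere 0 1)" for h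
    proof -
      obtain B where "\<forall>z\<in>sphere 0 1. cmod (h z) \<le> B"
        using b unfolding bounded_iff by auto
      then show ?thesis
        using L2_bounded_sphere[OF h] by blast
    qed
    from assms(1)[OF this[OF lin(1,2)] this[OF lin(3,4)]] show ?case
      by (simp add: lin(5,6))
  next
    case (lim F f B)
    have fB: "cmod (f z) \<le> B" if "z \<in> sphere 0 1" for z
      using lim(4)[OF that] lim(3)[OF that] by (intro tendsto_upperbound[OF tendsto_norm]) auto
    show ?case
    proof (rule limI)
      show "F n \<in> L2" for n
        using lim(1,3) by (rule L2_bounded_sphere)
      show "f \<in> L2"
        using lim(2) fB by (rule L2_bounded_sphere)
      show "(\<lambda>n. L2_norm (\<lambda>z. F n z - f z)) \<longlonglongrightarrow> 0"
      proof (rule L2_norm_tendsto_0[where w="\<lambda>_. (2 * B)\<^sup>2"])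
        show "AE z in circle. (cmod (F n z - f z))\<^sup>2 \<le> (2 * B)\<^sup>2" for n
        proof (rule AE_I2)
          fix z assume "z \<in> space circle"
          then have "z \<in> sphere 0 1" by simp
          then have "cmod (F n z - f z) \<le> 2 * B"
            using norm_triangle_ineq4[of "F n z" "f z"] fB[of z] lim(3)[of z n] by linarith
          then show "(cmod (F n z - f z))\<^sup>2 \<le> (2 * B)\<^sup>2"
            by (intro power_mono) auto
        qed
        show "AE z in circle. (\<lambda>n. F n z) \<longlonglongrightarrow> f z"
          using lim(4) by (intro AE_I2) simp
      qed (simp_all add: lim)
    qed (use lim in auto)
  qed (rule monom)
  \<comment> \<open>Truncation by size: each \<open>F n\<close> is bounded, and the squared error
    never exceeds the integrable square of \<open>cmod (f z)\<close>.\<close>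
  define F where "F n z = (if cmod (f z) \<le> real n then f z else 0)" for n z
  note [measurable] = f
  have F: "F n \<in> borel_measurable circle" for n
    unfolding F_def by measurable
  show ?thesis
  proof (rule lim)
    show "F n \<in> L2" for n
      using F by (rule L2_bounded_sphere[where B="real n"]) (simp add: F_def)
    show "(\<lambda>n. L2_norm (\<lambda>z. F n z - f z)) \<longlonglongrightarrow> 0"
    proof (rule L2_norm_tendsto_0[OF F _ L2_square_integrable[OF f]])
      show "AE z in circle. (\<lambda>n. F n z) \<longlonglongrightarrow> f z"
      proof (rule AE_I2)
        fix z
        obtain N where "cmod (f z) \<le> real N" using real_arch_simple by blast
        then have "\<forall>n\<ge>N. F n z = f z"
          unfolding F_def using le_trans[of N] by (auto intro: order_trans)
        then show "(\<lambda>n. F n z) \<longlonglongrightarrow> f z"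
          by (intro tendsto_eventually) (auto simp: eventually_sequentially)
      qed
    qed (auto simp: F_def L2_measurable[OF f])
    show "\<Lambda> (F n) = 0" for n
      using F by (rule bounded) (auto simp: F_def bounded_iff intro!: exI[of _ "real n"])
  qed fact
qed

section \<open>The slant operator and its adjoint\<close>

lemma circle_invariant:
  fixes u :: "complex \<Rightarrow> 'a :: {banach, second_countable_topology}"
  assumes T: "T \<in> circle \<rightarrow>\<^sub>M circle" "distr circle circle T = circle"
    and u: "u \<in> borel_measurable circle"
  shows "integrable circle (\<lambda>z. u (T z)) \<longleftrightarrow> integrable circle u"
    and "(LINT z|circle. u (T z)) = (LINT z|circle. u z)"
  using integrable_distr_eq[OF T(1) u] integral_distr[OF T(1) u] T(2) by simp_all

text \<open>Because the power map preserves arc length, preimages of null sets under it are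
  null.\<close>

lemma AE_circle_power:
  assumes "k \<ge> 1" "AE z in circle. P z"
  shows "AE z in circle. P (z ^ k)"
  using AE_distrD[OF circle_power_measurable[of k], of P] assms(2)
  unfolding distr_circle_power[OF assms(1)] by blast

lemma L2_compose_power:
  assumes "k \<ge> 1" "f \<in> L2"
  shows "(\<lambda>z. f (z ^ k)) \<in> L2"
proof
  note T = circle_power_measurable[of k] distr_circle_power[OF assms(1)]
  show "(\<lambda>z. f (z ^ k)) \<in> borel_measurable circle"
    using measurable_compose[OF T(1) L2_measurable[OF assms(2)]] .
  show "integrable circle (\<lambda>z. (cmod (f (z ^ k)))\<^sup>2)"
    using circle_invariant(1)[OF T, of "\<lambda>z. (cmod (f z))\<^sup>2"] L2_square_integrable[OF assms(2)]
    by (auto dest: borel_measurable_integrable)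
qed

text \<open>Otherwise all \<open>k\<close> roots of unity of order \<open>k\<close> would be roots
  of order \<open>m = n mod k\<close>, of which there are only \<open>m\<close>, with
  \<open>0 < m < k\<close>.\<close>

lemma exists_root_unity_powi_neq_1:
  assumes k: "k \<ge> 1" and n: "\<not> int k dvd n"
  shows "\<exists>\<zeta>::complex. \<zeta> ^ k = 1 \<and> \<zeta> powi n \<noteq> 1"
proof (rule ccontr)
  assume neg: "\<not> ?thesis"
  define m where "m = nat (n mod int k)"
  have "n mod int k \<ge> 0" "n mod int k < int k" "n mod int k \<noteq> 0"
    using k n by (simp_all add: dvd_eq_mod_eq_0)
  then have m: "m > 0" "m < k" "int m = n mod int k"
    by (simp_all add: m_def nat_less_iff)
  have "\<zeta> ^ m = 1" if "\<zeta> ^ k = 1" for \<zeta> :: complex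
  proof -
    have "\<zeta> \<noteq> 0" using that k by (auto simp: power_0_left)
    have "1 = \<zeta> powi (int k * (n div int k) + int m)"
      using neg that m by simp
    also have "\<dots> = \<zeta> ^ m"
      using \<open>\<zeta> \<noteq> 0\<close> that by (simp add: power_int_add power_int_mult)
    finally show ?thesis by simp
  qed
  then have "card {z::complex. z ^ k = 1} \<le> card {z::complex. z ^ m = 1}"
    using m by (intro card_mono finite_roots_unity) auto
  then show False
    using m by (simp add: card_roots_unity_eq)
qed

section \<open>Measurable roots and averages over them\<close>

text \<open>The principal root, a measurable right inverse of the power map on the circle. It labels
  the roots of \<open>z\<close> as \<open>\<omega> * circle_root k z\<close> with
  \<open>\<omega>\<close> a root of unity.\<close>

definition circle_root :: "nat \<Rightarrow> complex \<Rightarrow> complex" where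
  "circle_root k z = exp (Ln z / of_nat k)"

lemma circle_root_power:
  assumes "k \<ge> 1" "z \<noteq> 0"
  shows "circle_root k z ^ k = z"
  using assms by (simp add: circle_root_def flip: exp_of_nat_mult)

text \<open>The branch cut of \<open>Ln\<close> meets the circle only at \<open>-1\<close>. Removing
  that point leaves a continuous function, and on a single point continuity is automatic.\<close>

lemma circle_root_measurable:
  assumes k: "k \<ge> 1"
  shows "circle_root k \<in> circle \<rightarrow>\<^sub>M circle"
  unfolding measurable_circle_iff
proof
  show "circle_root k \<in> borel_measurable circle"
  proof (rule measurable_piecewise_restrict[where C="{{-1}, - {-1}}"])
    fix \<Omega> :: "complex set" assume \<Omega>: "\<Omega> \<in> {{-1}, - {-1}}"
    then have "\<Omega> \<in> sets borel" by auto
    then show "\<Omega> \<inter> space circle \<in> sets circle"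
      unfolding sets_circle sets_restrict_space space_circle by (auto simp: Int_commute)
    have "circle_root k \<in> borel_measurable (restrict_space borel (\<Omega> \<inter> sphere 0 1))"
    proof (cases "\<Omega> = {-1}")
      case True
      then show ?thesis
        by (intro borel_measurable_continuous_on_restrict continuous_on_subset[OF continuous_on_sing]) auto
    next
      case False
      then have "z \<notin> \<real>\<^sub>\<le>\<^sub>0" if "z \<in> \<Omega> \<inter> sphere 0 1" for z
        using that \<Omega> by (auto simp: complex_nonpos_Reals_iff complex_eq_iff norm_complex_def power2_eq_1_iff)
      then show ?thesis
        unfolding circle_root_def using k
        by (intro borel_measurable_continuous_on_restrict continuous_intros) auto
    qed
    moreover have "sets (restrict_space circle \<Omega>) = sets (restrict_space borel (\<Omega> \<inter> sphere 0 1))"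
      by (simp add: sets_restrict_space sets_circle image_image Int_assoc)
    ultimately show "circle_root k \<in> borel_measurable (restrict_space circle \<Omega>)"
      using measurable_cong_sets by blast
  qed auto
  show "\<forall>z\<in>sphere 0 1. cmod (circle_root k z) = 1"
  proof
    fix z :: complex assume z: "z \<in> sphere 0 1"
    then have "z \<noteq> 0" by auto
    with z show "cmod (circle_root k z) = 1"
      by (simp add: circle_root_def Re_divide_of_nat)
  qed
qed

text \<open>The average over the \<open>k\<close>-th roots is an explicit choice of \<open>W\<^sub>k\<close>.\<close>

definition slant_fun :: "nat \<Rightarrow> (complex \<Rightarrow> complex) \<Rightarrow> complex \<Rightarrow> complex" where
  "slant_fun k f z = (\<Sum>w | w ^ k = z. f w) / of_nat k"

text \<open>Multiplication by \<open>c\<close> carries the roots of unity bijectively onto the roots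
  of \<open>c ^ k\<close>, with division by \<open>c\<close> as inverse.\<close>

lemma sum_nth_roots:
  fixes c :: complex and f :: "complex \<Rightarrow> 'a :: comm_monoid_add"
  assumes "c \<noteq> 0"
  shows "(\<Sum>w | w ^ k = c ^ k. f w) = (\<Sum>\<omega> | \<omega> ^ k = 1. f (\<omega> * c))"
proof (rule sum.reindex_bij_betw[symmetric])
  show "bij_betw (\<lambda>\<omega>. \<omega> * c) {\<omega>. \<omega> ^ k = 1} {w. w ^ k = c ^ k}"
    by (rule bij_betw_byWitness[where f'="\<lambda>w. w / c"])
      (use assms in \<open>auto simp: power_mult_distrib power_divide\<close>)
qed

lemma root_unity_norm:
  assumes "k \<ge> 1" "(\<omega>::complex) ^ k = 1"
  shows "cmod \<omega> = 1"
proof -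
  have "cmod \<omega> ^ k = 1" using assms(2) by (metis norm_one norm_power)
  then show ?thesis using power_eq_imp_eq_base[of "cmod \<omega>" k 1] assms(1) by simp
qed

text \<open>Invariance under the power map allows \<open>z\<close> to be replaced by
  \<open>z ^ k\<close>. The root sum then runs over the rotations \<open>u (\<omega> * z)\<close>,
  each with the same integral as \<open>u\<close>, and there are \<open>k\<close> of them.\<close>

lemma root_average_invariant:
  fixes u :: "complex \<Rightarrow> 'a :: {banach, second_countable_topology}"
  assumes k: "k \<ge> 1" and u: "integrable circle u"
  shows "(\<lambda>z. \<Sum>w | w ^ k = z. u w) \<in> borel_measurable circle"
    and "integrable circle (\<lambda>z. \<Sum>w | w ^ k = z. u w)"
    and "(LINT z|circle. (\<Sum>w | w ^ k = z. u w)) = of_nat k *\<^sub>R (LINT z|circle. u z)"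
proof -
  have rot: "(\<lambda>z. \<omega> * T z) \<in> circle \<rightarrow>\<^sub>M circle" if "\<omega> ^ k = 1" "T \<in> circle \<rightarrow>\<^sub>M circle" for \<omega> T
    using measurable_compose[OF that(2) circle_rotate_measurable[OF root_unity_norm[OF k that(1)]]] .
  have um: "u \<in> borel_measurable circle" using u by auto
  \<comment> \<open>With a measurable root fixed, the sum over a varying root set becomes a fixed
    finite sum of measurable functions.\<close>
  have "(\<lambda>z. \<Sum>\<omega> | \<omega> ^ k = 1. u (\<omega> * circle_root k z)) \<in> borel_measurable circle"
    by (intro borel_measurable_sum measurable_compose[OF rot um] circle_root_measurable k) auto
  moreover have "(\<Sum>\<omega> | \<omega> ^ k = 1. u (\<omega> * circle_root k z)) = (\<Sum>w | w ^ k = z. u w)"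
    if "z \<in> space circle" for z
  proof -
    have "z \<noteq> 0" using that by auto
    then show ?thesis
      using sum_nth_roots[of "circle_root k z" u k] circle_root_power[OF k, of z]
      by (simp add: circle_root_def)
  qed
  ultimately show m: "(\<lambda>z. \<Sum>w | w ^ k = z. u w) \<in> borel_measurable circle"
    by (subst measurable_cong[symmetric])
  have rot_u: "integrable circle (\<lambda>z. u (\<omega> * z))" "(LINT z|circle. u (\<omega> * z)) = (LINT z|circle. u z)"
    if "\<omega> ^ k = 1" for \<omega>
    using circle_invariant[OF circle_rotate_measurable distr_circle_rotate um] root_unity_norm[OF k that] u
    by blast+
  have *: "(\<Sum>w | w ^ k = z ^ k. u w) = (\<Sum>\<omega> | \<omega> ^ k = 1. u (\<omega> * z))" if "z \<in> space circle" for z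
    using that by (intro sum_nth_roots) auto
  note inv = circle_invariant[OF circle_power_measurable distr_circle_power[OF k] m]
  have "integrable circle (\<lambda>z. \<Sum>\<omega> | \<omega> ^ k = 1. u (\<omega> * z))"
    using rot_u by (intro Bochner_Integration.integrable_sum) auto
  then show "integrable circle (\<lambda>z. \<Sum>w | w ^ k = z. u w)"
    unfolding inv(1)[symmetric] by (subst Bochner_Integration.integrable_cong[OF refl *])
  have "(LINT z|circle. (\<Sum>w | w ^ k = z. u w)) = (LINT z|circle. (\<Sum>\<omega> | \<omega> ^ k = 1. u (\<omega> * z)))"
    unfolding inv(2)[symmetric] by (rule Bochner_Integration.integral_cong[OF refl *])
  also have "\<dots> = (\<Sum>\<omega> | (\<omega>::complex) ^ k = 1. (LINT z|circle. u z))"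
    using rot_u by (subst Bochner_Integration.integral_sum) auto
  also have "\<dots> = of_nat k *\<^sub>R (LINT z|circle. u z)"
    using k by (simp add: sum_constant_scaleR card_roots_unity_eq)
  finally show "(LINT z|circle. (\<Sum>w | w ^ k = z. u w)) = of_nat k *\<^sub>R (LINT z|circle. u z)" .
qed

lemma L2_imp_integrable: "f \<in> L2 \<Longrightarrow> integrable circle f"
  using L2_mult_integrable[of f "\<lambda>z. 1"] L2_powi[of 0] by simp

text \<open>Cauchy-Schwarz over the \<open>k\<close> roots bounds the squared modulus of the average
  by the average of the squared moduli; the latter has the same integral as the square of
  \<open>cmod (f z)\<close>.\<close>

lemma slant_fun_L2:
  assumes k: "k \<ge> 1" and f: "f \<in> L2"
  shows "slant_fun k f \<in> L2" and "L2_norm (slant_fun k f) \<le> L2_norm f"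
proof -
  note avg = root_average_invariant[OF k L2_square_integrable[OF f]]
  have meas: "slant_fun k f \<in> borel_measurable circle"
    unfolding slant_fun_def
    using root_average_invariant(1)[OF k L2_imp_integrable[OF f]] by measurable
  have le: "(cmod (slant_fun k f z))\<^sup>2 \<le> (\<Sum>w | w ^ k = z. (cmod (f w))\<^sup>2) / k" if "z \<in> sphere 0 1" for z
  proof -
    have "z \<noteq> 0" using that by auto
    then have card: "card {w. w ^ k = z} = k"
      using k by (intro card_nth_roots) auto
    have "(cmod (slant_fun k f z))\<^sup>2 = (cmod (\<Sum>w | w ^ k = z. f w))\<^sup>2 / (real k)\<^sup>2"
      by (simp add: slant_fun_def norm_divide power_divide)
    also have "\<dots> \<le> (\<Sum>w | w ^ k = z. cmod (f w))\<^sup>2 / (real k)\<^sup>2"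
      by (intro divide_right_mono power_mono norm_sum) auto
    also have "\<dots> \<le> ((\<Sum>w | w ^ k = z. (cmod (f w))\<^sup>2) * k) / (real k)\<^sup>2"
      using sum_squared_le_sum_of_squares[of "\<lambda>w. cmod (f w)" "{w. w ^ k = z}"] card
      by (intro divide_right_mono) auto
    also have "\<dots> = (\<Sum>w | w ^ k = z. (cmod (f w))\<^sup>2) / k"
      using k by (simp add: power2_eq_square)
    finally show ?thesis .
  qed
  have int: "integrable circle (\<lambda>z. (\<Sum>w | w ^ k = z. (cmod (f w))\<^sup>2) / k)"
    using avg(2) by simp
  show L2: "slant_fun k f \<in> L2"
  proof (rule L2_I[OF meas Bochner_Integration.integrable_bound[OF int]])
    show "AE z in circle. norm ((cmod (slant_fun k f z))\<^sup>2) \<le> norm ((\<Sum>w | w ^ k = z. (cmod (f w))\<^sup>2) / real k)"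
    proof (rule AE_I2)
      fix z assume "z \<in> space circle"
      then show "norm ((cmod (slant_fun k f z))\<^sup>2) \<le> norm ((\<Sum>w | w ^ k = z. (cmod (f w))\<^sup>2) / real k)"
        using le[of z] by (simp add: sum_nonneg)
    qed
  qed (use meas in measurable)
  have "(LINT z|circle. (cmod (slant_fun k f z))\<^sup>2) \<le> (LINT z|circle. (\<Sum>w | w ^ k = z. (cmod (f w))\<^sup>2) / k)"
    by (rule integral_mono[OF L2_square_integrable[OF L2] int]) (simp add: le)
  also have "\<dots> = (LINT z|circle. (cmod (f z))\<^sup>2)"
    using avg(3) k by simp
  finally show "L2_norm (slant_fun k f) \<le> L2_norm f"
    by (simp add: L2_norm_def)
qed

text \<open>Writing the roots as \<open>\<omega> * c\<close> leaves a character sum over roots of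
  unity. It equals \<open>k\<close> if \<open>k\<close> divides \<open>n\<close>; otherwise
  multiplying by a root \<open>\<zeta>\<close> with \<open>\<zeta> powi n \<noteq> 1\<close>
  permutes the terms yet scales the sum, so it is 0.\<close>

lemma slant_fun_powi:
  assumes k: "k \<ge> 1" and z: "z \<noteq> 0"
  shows "slant_fun k (\<lambda>w. w powi n) z = (if int k dvd n then z powi (n div int k) else 0)"
proof -
  obtain c where c: "c \<noteq> 0" "c ^ k = z"
    using circle_root_power[OF assms] by (metis circle_root_def exp_not_eq_zero)
  have sum: "slant_fun k (\<lambda>w. w powi n) z = c powi n * (\<Sum>\<omega> | \<omega> ^ k = 1. \<omega> powi n) / k"
    using sum_nth_roots[OF c(1), of "\<lambda>w. w powi n" k] c(2)
    by (simp add: slant_fun_def power_int_mult_distrib sum_distrib_left mult.commute)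
  show ?thesis
  proof (cases "int k dvd n")
    case True
    then obtain m where n: "n = int k * m" by auto
    have "(\<Sum>\<omega> | (\<omega>::complex) ^ k = 1. \<omega> powi n) = (\<Sum>\<omega> | (\<omega>::complex) ^ k = 1. 1)"
      by (intro sum.cong) (auto simp: n power_int_mult)
    then show ?thesis
      using k c unfolding sum by (simp add: n card_roots_unity_eq power_int_mult)
  next
    case False
    obtain \<zeta> :: complex where \<zeta>: "\<zeta> ^ k = 1" "\<zeta> powi n \<noteq> 1"
      using exists_root_unity_powi_neq_1[OF k False] by blast
    then have "\<zeta> \<noteq> 0" using k by (auto simp: power_0_left)
    have "(\<Sum>\<omega> | \<omega> ^ k = 1. \<omega> powi n) = (\<Sum>\<omega> | \<omega> ^ k = 1. (\<omega> * \<zeta>) powi n)"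
      using sum_nth_roots[OF \<open>\<zeta> \<noteq> 0\<close>, of "\<lambda>w. w powi n" k] by (simp add: \<zeta>(1))
    also have "\<dots> = \<zeta> powi n * (\<Sum>\<omega> | \<omega> ^ k = 1. \<omega> powi n)"
      by (simp add: power_int_mult_distrib sum_distrib_left mult.commute)
    finally have "(\<Sum>\<omega> | (\<omega>::complex) ^ k = 1. \<omega> powi n) = 0"
      using \<zeta>(2) by simp
    then show ?thesis
      using False unfolding sum by simp
  qed
qed

text \<open>\<open>slant_fun\<close> witnesses that the specification is satisfiable, so the
  operator picked by \<open>SOME\<close> meets it as well.\<close>

lemma slant_op_properties:
  assumes k: "k \<ge> 1"
  shows "L2_bounded_op (slant_op k)"
    and "AE z in circle. slant_op k (\<lambda>w. w powi n) z = (if int k dvd n then z powi (n div int k) else 0)"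
proof -
  have lin: "slant_fun k (\<lambda>w. a * f w + b * g w) z = a * slant_fun k f z + b * slant_fun k g z" for a b f g z
    by (simp add: slant_fun_def sum.distrib sum_distrib_left add_divide_distrib)
  have "L2_bounded_op (slant_fun k)"
    unfolding L2_bounded_op_def lin
    using slant_fun_L2[OF k] by (auto intro!: exI[of _ 1])
  moreover have "AE z in circle. slant_fun k (\<lambda>w. w powi n) z = (if int k dvd n then z powi (n div int k) else 0)" for n
  proof (rule AE_I2)
    fix z assume "z \<in> space circle"
    then have "z \<noteq> 0" by auto
    then show "slant_fun k (\<lambda>w. w powi n) z = (if int k dvd n then z powi (n div int k) else 0)"
      by (rule slant_fun_powi[OF k])
  qed
  ultimately have "\<exists>T. L2_bounded_op T \<and> (\<forall>n::int. AE z in circle.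
      T (\<lambda>w. w powi n) z = (if int k dvd n then z powi (n div int k) else 0))"
    by blast
  from someI_ex[OF this]
  show "L2_bounded_op (slant_op k)"
    and "AE z in circle. slant_op k (\<lambda>w. w powi n) z = (if int k dvd n then z powi (n div int k) else 0)"
    unfolding slant_op_def by blast+
qed

text \<open>The difference of the two sides is a bounded linear functional of \<open>f\<close>, so
  monomials suffice. For \<open>n = k * m\<close> the sides agree by invariance under the power map.
  Otherwise both vanish: rotation by a root of unity fixes \<open>g (z ^ k)\<close> but multiplies
  \<open>z powi n\<close> by a factor other than 1.\<close>

lemma slant_op_adjoint:
  assumes k: "k \<ge> 1" and f: "f \<in> L2" and g: "g \<in> L2"
  shows "L2_inner (slant_op k f) g = L2_inner f (\<lambda>z. g (z ^ k))"
proof -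
  have T: "slant_op k f \<in> L2" if "f \<in> L2" for f
    using slant_op_properties(1)[OF k] that by (auto simp: L2_bounded_op_def)
  have T_lin: "AE z in circle. slant_op k (\<lambda>w. a * f w + b * g w) z = a * slant_op k f z + b * slant_op k g z"
    if "f \<in> L2" "g \<in> L2" for f g a b
    using slant_op_properties(1)[OF k] that by (auto simp: L2_bounded_op_def)
  obtain C where C: "L2_norm (slant_op k f) \<le> C * L2_norm f" if "f \<in> L2" for f
    using slant_op_properties(1)[OF k] unfolding L2_bounded_op_def by blast
  have gk: "(\<lambda>z. g (z ^ k)) \<in> L2" by (rule L2_compose_power[OF k g])
  define \<Lambda> where "\<Lambda> f = L2_inner (slant_op k f) g - L2_inner f (\<lambda>z. g (z ^ k))" for f
  have "\<Lambda> f = 0"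
  proof (rule L2_functional_eq_0[OF _ _ _ f])
    fix u v a b assume uv: "u \<in> L2" "v \<in> L2"
    have "L2_inner (slant_op k (\<lambda>z. a * u z + b * v z)) g
        = L2_inner (\<lambda>z. a * slant_op k u z + b * slant_op k v z) g"
      by (intro L2_inner_cong_AE T L2_lin uv g T_lin) auto
    then show "\<Lambda> (\<lambda>z. a * u z + b * v z) = a * \<Lambda> u + b * \<Lambda> v"
      using uv T g gk by (simp add: \<Lambda>_def L2_inner_lin algebra_simps)
  next
    fix u assume u: "u \<in> L2"
    have "cmod (\<Lambda> u) \<le> cmod (L2_inner (slant_op k u) g) + cmod (L2_inner u (\<lambda>z. g (z ^ k)))"
      unfolding \<Lambda>_def by (rule norm_triangle_ineq4)
    also have "\<dots> \<le> C * L2_norm u * L2_norm g + L2_norm u * L2_norm (\<lambda>z. g (z ^ k))"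
      using L2_Cauchy_Schwarz[OF T[OF u] g] L2_Cauchy_Schwarz[OF u gk]
        mult_right_mono[OF C[OF u] L2_norm_nonneg[of g]] by linarith
    finally show "cmod (\<Lambda> u) \<le> (C * L2_norm g + L2_norm (\<lambda>z. g (z ^ k))) * L2_norm u"
      by (simp add: algebra_simps)
  next
    fix n :: int
    let ?I = "L2_inner (\<lambda>z. z powi n) (\<lambda>z. g (z ^ k))"
    show "\<Lambda> (\<lambda>z. z powi n) = 0"
    proof (cases "int k dvd n")
      case True
      then obtain m where n: "n = int k * m" by auto
      have "L2_inner (slant_op k (\<lambda>z. z powi n)) g = L2_inner (\<lambda>z. z powi m) g"
        using slant_op_properties(2)[OF k, of n] k
        by (intro L2_inner_cong_AE T L2_powi g) (auto simp: n)
      also have "\<dots> = (LINT z|circle. (z ^ k) powi m * cnj (g (z ^ k)))"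
        unfolding L2_inner_def
        by (rule circle_invariant(2)[OF circle_power_measurable distr_circle_power[OF k], symmetric])
          (use L2_inner_integrable[OF L2_powi g] in auto)
      also have "\<dots> = ?I"
        by (simp add: L2_inner_def n power_int_mult)
      finally show ?thesis by (simp add: \<Lambda>_def)
    next
      case False
      obtain \<zeta> :: complex where \<zeta>: "\<zeta> ^ k = 1" "\<zeta> powi n \<noteq> 1"
        using exists_root_unity_powi_neq_1[OF k False] by blast
      note norm = root_unity_norm[OF k \<zeta>(1)]
      have "L2_inner (slant_op k (\<lambda>z. z powi n)) g = L2_inner (\<lambda>z. 0) g"
        using slant_op_properties(2)[OF k, of n] False L2_lin[OF g g, of 0 0]
        by (intro L2_inner_cong_AE T L2_powi g) auto
      moreover have "?I = \<zeta> powi n * ?I"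
      proof -
        have "?I = (LINT z|circle. (\<zeta> * z) powi n * cnj (g ((\<zeta> * z) ^ k)))"
          unfolding L2_inner_def
          by (rule circle_invariant(2)[OF circle_rotate_measurable[OF norm] distr_circle_rotate[OF norm], symmetric])
            (use L2_inner_integrable[OF L2_powi gk] in auto)
        then show ?thesis
          by (simp add: power_int_mult_distrib power_mult_distrib \<zeta>(1) mult.assoc L2_inner_def)
      qed
      then have "?I = 0" using \<zeta>(2) by simp
      ultimately show ?thesis by (simp add: \<Lambda>_def L2_inner_def)
    qed
  qed
  then show ?thesis by (simp add: \<Lambda>_def)
qed

section \<open>Hardy spaces\<close>

lemma L2_inner_sum:
  assumes "finite I" "\<And>i. i \<in> I \<Longrightarrow> f i \<in> L2" "h \<in> L2"
  shows "(\<lambda>z. \<Sum>i\<in>I. c i * f i z) \<in> L2"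
    and "L2_inner (\<lambda>z. \<Sum>i\<in>I. c i * f i z) h = (\<Sum>i\<in>I. c i * L2_inner (f i) h)"
proof -
  have "(\<lambda>z. \<Sum>i\<in>I. c i * f i z) \<in> L2 \<and>
    L2_inner (\<lambda>z. \<Sum>i\<in>I. c i * f i z) h = (\<Sum>i\<in>I. c i * L2_inner (f i) h)"
    using assms
  proof (induction I)
    case empty
    then show ?case using L2_lin[of h h 0 0] by (simp add: L2_inner_def)
  next
    case (insert i I)
    then show ?case
      using L2_lin[of "f i" "\<lambda>z. \<Sum>i\<in>I. c i * f i z" "c i" 1]
        L2_inner_lin[of "f i" "\<lambda>z. \<Sum>i\<in>I. c i * f i z" h "c i" 1] by simp
  qed
  then show "(\<lambda>z. \<Sum>i\<in>I. c i * f i z) \<in> L2"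
    and "L2_inner (\<lambda>z. \<Sum>i\<in>I. c i * f i z) h = (\<Sum>i\<in>I. c i * L2_inner (f i) h)"
    by auto
qed

lemma L2_power: "(\<lambda>z. z ^ n) \<in> L2"
  by (intro L2_continuous continuous_intros)

lemma L2_inner_power: "L2_inner (\<lambda>z. z ^ m) (\<lambda>z. z ^ n) = (if m = n then 1 else 0)"
proof -
  have "L2_inner (\<lambda>z. z ^ m) (\<lambda>z. z ^ n) = (LINT z|circle. z powi (int m - int n))"
    unfolding L2_inner_def
  proof (rule Bochner_Integration.integral_cong)
    fix z assume "z \<in> space circle"
    then have z: "cmod z = 1" "z \<noteq> 0" by auto
    have "cnj z = inverse z"
      using z by (intro inverse_unique[symmetric]) (simp flip: complex_norm_square)
    then show "z ^ m * cnj (z ^ n) = z powi (int m - int n)"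
      using z by (simp add: power_int_diff divide_inverse power_inverse)
  qed simp
  then show ?thesis by (simp add: integral_circle_powi)
qed

text \<open>For partial sums this is orthonormality of the powers. Absolute summability dominates
  all partial sums by one constant, so dominated convergence gives the limit.\<close>

lemma circle_Parseval:
  assumes a: "summable (\<lambda>n. cmod (a n))"
  shows "(\<lambda>n. (cmod (a n))\<^sup>2) sums (LINT z|circle. (cmod (\<Sum>n. a n * z ^ n))\<^sup>2)"
proof -
  define s where "s N z = (\<Sum>n<N. a n * z ^ n)" for N z
  define S where "S z = (\<Sum>n. a n * z ^ n)" for z
  have s_L2: "s N \<in> L2" for N
    unfolding s_def by (rule L2_inner_sum(1)[OF finite_lessThan L2_power L2_power])
  have summ: "summable (\<lambda>n. cmod (a n * z ^ n))" if "z \<in> sphere 0 1" for z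
    using a that by (simp add: norm_mult norm_power)
  have lim: "(\<lambda>N. s N z) \<longlonglongrightarrow> S z" if "z \<in> sphere 0 1" for z
    unfolding s_def S_def
    using summable_sums[OF summable_norm_cancel[OF summ[OF that]]] by (simp add: sums_def)
  have bound: "cmod (s N z) \<le> (\<Sum>n. cmod (a n))" if "z \<in> sphere 0 1" for N z
  proof -
    have "cmod (s N z) \<le> (\<Sum>n<N. cmod (a n * z ^ n))"
      unfolding s_def by (rule norm_sum)
    also have "\<dots> = (\<Sum>n<N. cmod (a n))"
      using that by (simp add: norm_mult norm_power)
    also have "\<dots> \<le> (\<Sum>n. cmod (a n))"
      by (intro sum_le_suminf a) auto
    finally show ?thesis .
  qed
  have "S \<in> borel_measurable circle"
    by (rule borel_measurable_LIMSEQ_metric[where f=s]) (simp_all add: L2_measurable s_L2 lim)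
  note [measurable] = this L2_measurable[OF s_L2]
  have "L2_inner (s N) (s N) = of_real (\<Sum>n<N. (cmod (a n))\<^sup>2)" for N
  proof -
    have "L2_inner (\<lambda>z. z ^ m) (s N) = (if m < N then cnj (a m) else 0)" for m
    proof -
      have "L2_inner (s N) (\<lambda>z. z ^ m) = (\<Sum>n<N. a n * L2_inner (\<lambda>z. z ^ n) (\<lambda>z. z ^ m))"
        unfolding s_def by (intro L2_inner_sum(2) L2_power) auto
      also have "\<dots> = (\<Sum>n<N. if n = m then a n else 0)"
        by (intro sum.cong) (auto simp: L2_inner_power)
      also have "\<dots> = (if m < N then a m else 0)"
        by simp
      finally show ?thesis
        using L2_inner_commute[of "\<lambda>z. z ^ m" "s N"] by (simp split: if_splits)
    qed
    moreover have "L2_inner (s N) (s N) = (\<Sum>n<N. a n * L2_inner (\<lambda>z. z ^ n) (s N))"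
      unfolding s_def[of N, abs_def]
      by (intro L2_inner_sum(2) L2_power s_L2[of N, unfolded s_def[of N, abs_def]]) auto
    ultimately show ?thesis
      by (simp add: complex_norm_square[symmetric])
  qed
  then have "(L2_norm (s N))\<^sup>2 = (\<Sum>n<N. (cmod (a n))\<^sup>2)" for N
    unfolding L2_inner_self using of_real_eq_iff by blast
  then have partial: "(LINT z|circle. (cmod (s N z))\<^sup>2) = (\<Sum>n<N. (cmod (a n))\<^sup>2)" for N
    by (simp add: L2_norm_def)
  have "(\<lambda>N. LINT z|circle. (cmod (s N z))\<^sup>2) \<longlonglongrightarrow> (LINT z|circle. (cmod (S z))\<^sup>2)"
  proof (rule integral_dominated_convergence[where w="\<lambda>_. (\<Sum>n. cmod (a n))\<^sup>2"])
    show "AE z in circle. (\<lambda>N. (cmod (s N z))\<^sup>2) \<longlonglongrightarrow> (cmod (S z))\<^sup>2"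
      by (rule AE_I2) (intro tendsto_intros lim, simp)
    show "AE z in circle. norm ((cmod (s N z))\<^sup>2) \<le> (\<Sum>n. cmod (a n))\<^sup>2" for N
      by (rule AE_I2) (simp add: power_mono bound)
  qed (simp, measurable)
  then show ?thesis
    unfolding partial sums_def S_def .
qed

text \<open>Fatou's lemma for nonnegative \<open>ennreal\<close> integrals, carried over to real
  ones by square integrability.\<close>

lemma L2_norm_Fatou:
  assumes G: "\<And>m::nat. G m \<in> L2" and g: "g \<in> L2"
    and lim: "AE z in circle. (\<lambda>m. G m z) \<longlonglongrightarrow> g z"
    and le: "\<And>m. (LINT z|circle. (cmod (G m z))\<^sup>2) \<le> B"
  shows "(LINT z|circle. (cmod (g z))\<^sup>2) \<le> B"
proof -
  note [measurable] = L2_measurable[OF G] L2_measurable[OF g]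
  have nn: "(\<integral>\<^sup>+z. ennreal ((cmod (h z))\<^sup>2) \<partial>circle) = ennreal (LINT z|circle. (cmod (h z))\<^sup>2)"
    if "h \<in> L2" for h
    by (rule nn_integral_eq_integral[OF L2_square_integrable[OF that]]) simp
  have "ennreal (LINT z|circle. (cmod (g z))\<^sup>2) = (\<integral>\<^sup>+z. liminf (\<lambda>m. ennreal ((cmod (G m z))\<^sup>2)) \<partial>circle)"
    unfolding nn[OF g, symmetric]
  proof (rule nn_integral_cong_AE)
    show "AE z in circle. ennreal ((cmod (g z))\<^sup>2) = liminf (\<lambda>m. ennreal ((cmod (G m z))\<^sup>2))"
      using lim
    proof eventually_elim
      case (elim z)
      then have "(\<lambda>m. ennreal ((cmod (G m z))\<^sup>2)) \<longlonglongrightarrow> ennreal ((cmod (g z))\<^sup>2)"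
        by (intro tendsto_intros tendsto_ennrealI)
      then show ?case
        by (intro lim_imp_Liminf[symmetric]) auto
    qed
  qed
  also have "\<dots> \<le> liminf (\<lambda>m. \<integral>\<^sup>+z. ennreal ((cmod (G m z))\<^sup>2) \<partial>circle)"
    by (rule nn_integral_liminf) measurable
  also have "\<dots> \<le> liminf (\<lambda>m. ennreal B)"
    unfolding nn[OF G] by (intro Liminf_mono always_eventually allI ennreal_leI le)
  also have "\<dots> = ennreal B"
    by (simp add: Liminf_const)
  \<comment> \<open>Without this sign, \<open>ennreal B\<close> could be a truncation to 0 and the
    inequality would not return to the reals.\<close>
  moreover have "0 \<le> B"
    using le[of 0] by (rule order_trans[rotated]) simp
  ultimately show ?thesis
    by (simp add: ennreal_le_iff)
qed

section \<open>Radial limits and Taylor approximation in the Hardy space\<close>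

text \<open>A sequence of radii makes radial limits accessible to Fatou's lemma and to measurability
  of sequential limits. The shift by 2 keeps every radius in the interval from 1/2 to 1, the right
  end excluded.\<close>

lemma radii_tendsto_1: "filterlim (\<lambda>m. 1 - 1 / real (m + 2)) (at_left 1) sequentially"
proof (rule tendsto_imp_filterlim_at_left)
  have "(\<lambda>m. 1 - 1 / real (m + 2)) \<longlonglongrightarrow> 1 - 0"
    by (intro tendsto_intros LIMSEQ_ignore_initial_segment[OF lim_1_over_n])
  then show "(\<lambda>m. 1 - 1 / real (m + 2)) \<longlonglongrightarrow> 1" by simp
qed simp

lemma radial_tendsto_radii:
  "radial_tendsto F z l \<Longrightarrow> (\<lambda>m. F (of_real (1 - 1 / real (m + 2)) * z)) \<longlonglongrightarrow> l"
  unfolding radial_tendsto_def by (rule filterlim_compose[OF _ radii_tendsto_1])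

lemma radial_tendsto_unique: "radial_tendsto F z l \<Longrightarrow> radial_tendsto F z l' \<Longrightarrow> l = l'"
  unfolding radial_tendsto_def by (rule tendsto_unique[OF trivial_limit_at_left_real])

lemma radial_tendsto_mult:
  "radial_tendsto F z l \<Longrightarrow> radial_tendsto G z l' \<Longrightarrow> radial_tendsto (\<lambda>w. F w * G w) z (l * l')"
  unfolding radial_tendsto_def by (rule tendsto_mult)

lemma dilate_mem_ball: "0 \<le> r \<Longrightarrow> r < 1 \<Longrightarrow> z \<in> sphere 0 1 \<Longrightarrow> of_real r * z \<in> ball (0::complex) 1"
  by (simp add: norm_mult)

lemma dilate_L2:
  assumes F: "F holomorphic_on ball 0 1" and r: "0 \<le> r" "r < 1"
  shows "(\<lambda>z. F (of_real r * z)) \<in> L2"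
proof (rule L2_continuous)
  show "continuous_on (sphere 0 1) (\<lambda>z. F (of_real r * z))"
    by (rule continuous_on_compose2[OF holomorphic_on_imp_continuous_on[OF F]])
      (use dilate_mem_ball[OF r] in \<open>auto intro!: continuous_intros\<close>)
qed

text \<open>The polynomials are Taylor sections of the analytic extension \<open>F\<close>. Parseval
  on smaller circles with the bound \<open>C\<close> makes the coefficients square summable, and
  Fatou bounds the squared boundary error by the tail of that series.\<close>

lemma H2_Taylor_approx:
  assumes f: "f \<in> H2"
  shows "\<exists>a. (\<lambda>N. L2_norm (\<lambda>z. f z - (\<Sum>n<N. a n * z ^ n))) \<longlonglongrightarrow> 0"
proof -
  obtain F C where F: "F holomorphic_on ball 0 1"
    and C: "\<forall>r\<in>{0..<1::real}. (LINT z|circle. (cmod (F (of_real r * z)))\<^sup>2) \<le> C"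
    and lim: "AE z in circle. radial_tendsto F z (f z)"
    using f by (auto simp: H2_def)
  have fL2: "f \<in> L2" using f by (simp add: H2_def)
  define a where "a n = (deriv ^^ n) F 0 / fact n" for n
  have sums: "(\<lambda>n. a n * w ^ n) sums F w" if "w \<in> ball 0 1" for w
    using holomorphic_power_series[OF F that] by (simp add: a_def)
  \<comment> \<open>Convergence at the larger radius \<open>(1 + r) / 2 < 1\<close> forces absolute
    convergence at radius \<open>r\<close>.\<close>
  have abs: "summable (\<lambda>n. cmod (a n * of_real r ^ n))" if r: "0 \<le> r" "r < 1" for r
  proof (rule powser_insidea)
    show "summable (\<lambda>n. a n * of_real ((1 + r) / 2) ^ n)"
      using sums[of "of_real ((1 + r) / 2)"] r by (intro sums_summable) (auto simp: norm_divide simp del: of_real_add of_real_divide)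
    show "norm (complex_of_real r) < norm (complex_of_real ((1 + r) / 2))"
      using r by (simp del: of_real_add of_real_divide)
  qed
  \<comment> \<open>Zeroing the first \<open>N\<close> coefficients gives the squared mean of the
    Taylor remainder; \<open>N = 0\<close> gives that of \<open>F\<close> itself.\<close>
  have Parseval: "(\<lambda>n. (cmod (if n < N then 0 else a n))\<^sup>2 * r ^ (2 * n)) sums
      (LINT z|circle. (cmod (F (of_real r * z) - (\<Sum>n<N. a n * (of_real r * z) ^ n)))\<^sup>2)"
    if r: "0 \<le> r" "r < 1" for r N
  proof -
    define b where "b n = (if n < N then 0 else a n) * of_real r ^ n" for n
    have "summable (\<lambda>n. cmod (b n))"
      by (rule summable_comparison_test'[OF abs[OF r], of 0]) (simp add: b_def)
    from circle_Parseval[OF this]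
    have "(\<lambda>n. (cmod (b n))\<^sup>2) sums (LINT z|circle. (cmod (\<Sum>n. b n * z ^ n))\<^sup>2)" .
    also have "(LINT z|circle. (cmod (\<Sum>n. b n * z ^ n))\<^sup>2) =
      (LINT z|circle. (cmod (F (of_real r * z) - (\<Sum>n<N. a n * (of_real r * z) ^ n)))\<^sup>2)"
    proof (rule Bochner_Integration.integral_cong)
      fix z assume "z \<in> space circle"
      then have w: "of_real r * z \<in> ball 0 1"
        using dilate_mem_ball[OF r] by simp
      have "(\<lambda>n. if n \<in> {..<N} then a n * (of_real r * z) ^ n else 0) sums (\<Sum>n<N. a n * (of_real r * z) ^ n)"
        by (rule sums_If_finite_set) simp
      from sums_diff[OF sums[OF w] this]
      have "(\<lambda>n. b n * z ^ n) sums (F (of_real r * z) - (\<Sum>n<N. a n * (of_real r * z) ^ n))"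
        by (rule sums_cong[THEN iffD1, rotated]) (simp add: b_def power_mult_distrib)
      then show "(cmod (\<Sum>n. b n * z ^ n))\<^sup>2 = (cmod (F (of_real r * z) - (\<Sum>n<N. a n * (of_real r * z) ^ n)))\<^sup>2"
        by (simp add: sums_unique[symmetric])
    qed simp
    finally show ?thesis
      using r by (simp add: b_def norm_mult norm_power power_mult_distrib power_mult power_even_eq mult.commute[of 2])
  qed
  \<comment> \<open>For a finite sum the radius may tend to 1, while every mean stays below
    \<open>C\<close>.\<close>
  have "(\<Sum>n<N. (cmod (a n))\<^sup>2) \<le> C" for N
  proof (rule tendsto_upperbound)
    show "((\<lambda>r. \<Sum>n<N. (cmod (a n))\<^sup>2 * r ^ (2 * n)) \<longlongrightarrow> (\<Sum>n<N. (cmod (a n))\<^sup>2)) (at_left (1::real))"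
      by (auto intro!: tendsto_eq_intros)
    have "(\<Sum>n<N. (cmod (a n))\<^sup>2 * r ^ (2 * n)) \<le> C" if r: "r \<in> {0<..<1}" for r :: real
    proof -
      have "(\<lambda>n. (cmod (a n))\<^sup>2 * r ^ (2 * n)) sums (LINT z|circle. (cmod (F (of_real r * z)))\<^sup>2)"
        using Parseval[of r 0] r by simp
      then have "(\<Sum>n<N. (cmod (a n))\<^sup>2 * r ^ (2 * n)) \<le> (LINT z|circle. (cmod (F (of_real r * z)))\<^sup>2)"
        using r sum_le_suminf[of "\<lambda>n. (cmod (a n))\<^sup>2 * r ^ (2 * n)" "{..<N}"] by (simp add: sums_iff)
      also have "\<dots> \<le> C"
        using C r by simp
      finally show ?thesis .
    qed
    then show "eventually (\<lambda>r. (\<Sum>n<N. (cmod (a n))\<^sup>2 * r ^ (2 * n)) \<le> C) (at_left (1::real))"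
      by (intro eventually_at_leftI[of 0]) auto
  qed simp
  then have summ: "summable (\<lambda>n. (cmod (a n))\<^sup>2)"
    by (intro bounded_imp_summable[where B=C]) (simp_all only: zero_le_power2 flip: lessThan_Suc_atMost)
  define \<tau> where "\<tau> N = (\<Sum>n. (cmod (a n))\<^sup>2) - (\<Sum>n<N. (cmod (a n))\<^sup>2)" for N
  have "\<tau> \<longlonglongrightarrow> (\<Sum>n. (cmod (a n))\<^sup>2) - (\<Sum>n. (cmod (a n))\<^sup>2)"
    unfolding \<tau>_def using summable_LIMSEQ[OF summ] by (intro tendsto_intros)
  then have \<tau>: "\<tau> \<longlonglongrightarrow> 0" by simp
  have tail: "(\<lambda>n. (cmod (if n < N then 0 else a n))\<^sup>2) sums \<tau> N" for N
  proof -
    have "(\<lambda>n. if n \<in> {..<N} then (cmod (a n))\<^sup>2 else 0) sums (\<Sum>n<N. (cmod (a n))\<^sup>2)"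
      by (rule sums_If_finite_set) simp
    from sums_diff[OF summable_sums[OF summ] this]
    show ?thesis
      unfolding \<tau>_def by (rule sums_cong[THEN iffD1, rotated]) simp
  qed
  define p where "p N z = (\<Sum>n<N. a n * z ^ n)" for N z
  have p_L2: "p N \<in> L2" for N
    unfolding p_def by (rule L2_inner_sum(1)[OF finite_lessThan L2_power L2_power])
  have p_hol: "p N holomorphic_on ball 0 1" for N
    unfolding p_def by (intro holomorphic_intros)
  \<comment> \<open>Along the radii the remainder tends to \<open>f - p N\<close> almost everywhere,
    and the factors \<open>r ^ (2 * n) \<le> 1\<close> keep its squared means below
    \<open>\<tau> N\<close>.\<close>
  have "(LINT z|circle. (cmod (f z - p N z))\<^sup>2) \<le> \<tau> N" for N
  proof (rule L2_norm_Fatou)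
    let ?r = "\<lambda>m. 1 - 1 / real (m + 2)"
    have r: "0 \<le> ?r m" "?r m < 1" for m by simp_all
    show "(\<lambda>z. F (of_real (?r m) * z) - p N (of_real (?r m) * z)) \<in> L2" for m
      by (intro L2_diff dilate_L2 F p_hol r)
    show "(\<lambda>z. f z - p N z) \<in> L2"
      by (intro L2_diff fL2 p_L2)
    have p_lim: "radial_tendsto (p N) z (p N z)" for z
      unfolding radial_tendsto_def p_def by (auto intro!: tendsto_eq_intros)
    show "AE z in circle. (\<lambda>m. F (of_real (?r m) * z) - p N (of_real (?r m) * z)) \<longlonglongrightarrow> f z - p N z"
      using lim by eventually_elim (intro tendsto_diff radial_tendsto_radii p_lim)
    show "(LINT z|circle. (cmod (F (of_real (?r m) * z) - p N (of_real (?r m) * z)))\<^sup>2) \<le> \<tau> N" for m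
      unfolding p_def
    proof (rule sums_le[OF _ Parseval[OF r] tail])
      show "(cmod (if n < N then 0 else a n))\<^sup>2 * (?r m) ^ (2 * n) \<le> (cmod (if n < N then 0 else a n))\<^sup>2" for n
        using r[of m] by (intro mult_left_le power_le_one) auto
    qed
  qed
  then have le: "norm (L2_norm (\<lambda>z. f z - p N z)) \<le> sqrt (\<tau> N)" for N
    by (simp add: L2_norm_def)
  have "(\<lambda>N. sqrt (\<tau> N)) \<longlonglongrightarrow> 0"
    using tendsto_real_sqrt[OF \<tau>] by simp
  from Lim_null_comparison[OF always_eventually[OF allI[OF le]] this]
  have "(\<lambda>N. L2_norm (\<lambda>z. f z - p N z)) \<longlonglongrightarrow> 0" .
  then show ?thesis
    unfolding p_def by blast
qed

lemma H2_imp_L2: "f \<in> H2 \<Longrightarrow> f \<in> L2"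
  by (simp add: H2_def)

text \<open>Subtracting a Taylor section from \<open>f\<close> does not change the pairing with
  \<open>g\<close>, while Cauchy-Schwarz makes it arbitrarily small.\<close>

lemma H2_inner_eq_0:
  assumes f: "f \<in> H2" and g: "g \<in> L2" and 0: "\<And>n::nat. L2_inner (\<lambda>z. z ^ n) g = 0"
  shows "L2_inner f g = 0"
proof -
  obtain a where a: "(\<lambda>N. L2_norm (\<lambda>z. f z - (\<Sum>n<N. a n * z ^ n))) \<longlonglongrightarrow> 0"
    using H2_Taylor_approx[OF f] by blast
  note fL2 = H2_imp_L2[OF f]
  have "cmod (L2_inner f g) \<le> L2_norm (\<lambda>z. f z - (\<Sum>n<N. a n * z ^ n)) * L2_norm g" for N
  proof -
    define p where "p z = (\<Sum>n<N. a n * z ^ n)" for z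
    have p: "p \<in> L2" "L2_inner p g = 0"
      unfolding p_def using L2_inner_sum[OF finite_lessThan[of N] L2_power g, of a] 0 by simp_all
    have "L2_inner (\<lambda>z. f z - p z) g = L2_inner f g"
      using L2_inner_lin[OF fL2 p(1) g, of 1 "-1"] p(2) by simp
    then show ?thesis
      using L2_Cauchy_Schwarz[OF L2_diff[OF fL2 p(1)] g] by (simp add: p_def)
  qed
  moreover have "(\<lambda>N. L2_norm (\<lambda>z. f z - (\<Sum>n<N. a n * z ^ n)) * L2_norm g) \<longlonglongrightarrow> 0 * L2_norm g"
    by (intro tendsto_intros a)
  ultimately have "cmod (L2_inner f g) \<le> 0 * L2_norm g"
    by (intro tendsto_lowerbound[of _ "0 * L2_norm g" sequentially]) auto
  then show ?thesis by simp
qed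

section \<open>Bounded analytic functions as multipliers\<close>

lemma Hinf_bounded:
  assumes "g \<in> Hinf"
  shows "\<exists>B. AE z in circle. cmod (g z) \<le> B"
proof -
  obtain G where G: "bounded (G ` ball 0 1)" "AE z in circle. radial_tendsto G z (g z)"
    using assms by (auto simp: Hinf_def)
  obtain B where B: "\<And>w. w \<in> ball 0 1 \<Longrightarrow> cmod (G w) \<le> B"
    using G(1) unfolding bounded_iff by blast
  have "AE z in circle. cmod (g z) \<le> B"
    using G(2) AE_space
  proof eventually_elim
    case (elim z)
    have "cmod (G (of_real (1 - 1 / real (m + 2)) * z)) \<le> B" for m
      using elim(2) by (intro B dilate_mem_ball) auto
    then show ?case
      by (intro tendsto_upperbound[OF tendsto_norm[OF radial_tendsto_radii[OF elim(1)]]]) auto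
  qed
  then show ?thesis by blast
qed

lemma Hinf_imp_L2: "f \<in> Hinf \<Longrightarrow> f \<in> L2"
  by (simp add: Hinf_def)

text \<open>The product of the two extensions serves as extension: a bound \<open>B\<close> on
  \<open>G\<close> multiplies the squared means by at most the square of \<open>B\<close>, and
  radial limits multiply.\<close>

lemma H2_mult_Hinf:
  assumes f: "f \<in> H2" and g: "g \<in> Hinf"
  shows "(\<lambda>z. f z * g z) \<in> H2"
proof -
  obtain F C where F: "F holomorphic_on ball 0 1"
    and C: "\<forall>r\<in>{0..<1::real}. (LINT z|circle. (cmod (F (of_real r * z)))\<^sup>2) \<le> C"
    and limF: "AE z in circle. radial_tendsto F z (f z)"
    using f by (auto simp: H2_def)
  obtain G where G: "G holomorphic_on ball 0 1" "bounded (G ` ball 0 1)"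
    "AE z in circle. radial_tendsto G z (g z)"
    using g by (auto simp: Hinf_def)
  obtain B where B: "\<And>w. w \<in> ball 0 1 \<Longrightarrow> cmod (G w) \<le> B"
    using G(2) unfolding bounded_iff by blast
  obtain B' where B': "AE z in circle. cmod (g z) \<le> B'"
    using Hinf_bounded[OF g] by blast
  have "(\<lambda>z. g z * f z) \<in> L2"
    by (rule L2_mult_bounded[OF H2_imp_L2[OF f] L2_measurable[OF Hinf_imp_L2[OF g]] B'])
  then have "(\<lambda>z. f z * g z) \<in> L2"
    by (simp add: mult.commute)
  moreover have FG: "(\<lambda>w. F w * G w) holomorphic_on ball 0 1"
    by (intro holomorphic_intros F G)
  moreover have "(LINT z|circle. (cmod (F (of_real r * z) * G (of_real r * z)))\<^sup>2) \<le> B\<^sup>2 * C"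
    if "r \<in> {0..<1}" for r
  proof -
    have r: "0 \<le> r" "r < 1" using that by auto
    have "(LINT z|circle. (cmod (F (of_real r * z) * G (of_real r * z)))\<^sup>2)
      \<le> (LINT z|circle. B\<^sup>2 * (cmod (F (of_real r * z)))\<^sup>2)"
    proof (rule integral_mono)
      show "integrable circle (\<lambda>z. (cmod (F (of_real r * z) * G (of_real r * z)))\<^sup>2)"
        by (rule L2_square_integrable[OF dilate_L2[OF FG r]])
      show "integrable circle (\<lambda>z. B\<^sup>2 * (cmod (F (of_real r * z)))\<^sup>2)"
        using L2_square_integrable[OF dilate_L2[OF F r]] by simp
      fix z assume "z \<in> space circle"
      then have "cmod (G (of_real r * z)) \<le> B"
        using dilate_mem_ball[OF r] by (intro B) simp
      then have "(cmod (G (of_real r * z)))\<^sup>2 \<le> B\<^sup>2"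
        by (intro power_mono) auto
      then show "(cmod (F (of_real r * z) * G (of_real r * z)))\<^sup>2 \<le> B\<^sup>2 * (cmod (F (of_real r * z)))\<^sup>2"
        by (simp add: norm_mult power_mult_distrib mult.commute[of "B\<^sup>2"] mult_left_mono)
    qed
    also have "\<dots> = B\<^sup>2 * (LINT z|circle. (cmod (F (of_real r * z)))\<^sup>2)"
      by simp
    also have "\<dots> \<le> B\<^sup>2 * C"
      using C that by (intro mult_left_mono) auto
    finally show ?thesis .
  qed
  moreover have "AE z in circle. radial_tendsto (\<lambda>w. F w * G w) z (f z * g z)"
    using limF G(3) by eventually_elim (rule radial_tendsto_mult)
  ultimately show ?thesis
    unfolding H2_def by blast
qed

lemma radial_tendsto_continuous:
  assumes "isCont F z"
  shows "radial_tendsto F z (F z)"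
proof -
  have "((\<lambda>r. of_real r * z) \<longlongrightarrow> z) (at_left (1::real))"
    by (auto intro!: tendsto_eq_intros)
  then show ?thesis
    unfolding radial_tendsto_def by (rule isCont_tendsto_compose[OF assms])
qed

lemma Hinf_power: "(\<lambda>z. z ^ n) \<in> Hinf"
proof -
  have "bounded ((\<lambda>z::complex. z ^ n) ` ball 0 1)"
    by (intro boundedI[of _ 1]) (auto simp: norm_power power_le_one)
  moreover have "AE z in circle. radial_tendsto (\<lambda>z. z ^ n) z (z ^ n)"
    by (intro AE_I2 radial_tendsto_continuous continuous_intros)
  moreover have "(\<lambda>z::complex. z ^ n) holomorphic_on ball 0 1"
    by (intro holomorphic_intros)
  ultimately show ?thesis
    unfolding Hinf_def using L2_power by blast
qed

lemma H2_const: "(\<lambda>z. c) \<in> H2"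
proof -
  have "(\<lambda>z. c) holomorphic_on ball 0 1" by simp
  moreover have "AE z in circle. radial_tendsto (\<lambda>z. c) z c"
    by (simp add: radial_tendsto_def)
  moreover have "(\<lambda>z. c) \<in> L2"
    by (intro L2_continuous continuous_intros)
  ultimately show ?thesis
    unfolding H2_def by (auto intro!: exI[of _ "\<lambda>z. c"])
qed

lemma H2_power: "(\<lambda>z. z ^ n) \<in> H2"
  using H2_mult_Hinf[OF H2_const Hinf_power, of 1 n] by simp

text \<open>\<^term>\<open>bval \<beta>\<close> itself is a definite description and not evidently measurable.\<close>

lemma inner_function_boundary:
  assumes "inner_function \<beta>"
  obtains b where "b \<in> borel_measurable circle" "AE z in circle. bval \<beta> z = b z"
    "AE z in circle. cmod (b z) = 1"
proof
  \<comment> \<open>A sequential limit of continuous dilates is measurable, and it equals the radial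
    limit wherever that exists.\<close>
  define b where "b z = lim (\<lambda>m. \<beta> (of_real (1 - 1 / real (m + 2)) * z))" for z
  have \<beta>: "\<beta> holomorphic_on ball 0 1" "AE z in circle. \<exists>l. radial_tendsto \<beta> z l \<and> cmod l = 1"
    using assms by (auto simp: inner_function_def)
  have "(\<lambda>z. \<beta> (of_real (1 - 1 / real (m + 2)) * z)) \<in> borel_measurable circle" for m
    by (intro L2_measurable dilate_L2 \<beta>) auto
  then show "b \<in> borel_measurable circle"
    unfolding b_def by (rule borel_measurable_lim_metric)
  have *: "bval \<beta> z = l" "b z = l" if "radial_tendsto \<beta> z l" for z l
    unfolding bval_def b_def
    using that radial_tendsto_unique limI[OF radial_tendsto_radii[OF that]] by (auto intro: the_equality)
  show "AE z in circle. bval \<beta> z = b z" "AE z in circle. cmod (b z) = 1"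
    using \<beta>(2) by (eventually_elim; use * in force)+
qed

section \<open>The model projection and the vanishing of the truncated operator\<close>

text \<open>The zero function meets the specification, so the chosen \<open>g\<close> does too. Both
  \<open>F\<close> and \<open>F - g\<close> are then orthogonal to \<open>g\<close>, which makes
  \<open>g\<close> orthogonal to itself.\<close>

lemma model_proj_eq_0:
  assumes F: "F \<in> L2" and 0: "\<And>g. g \<in> model_space \<beta> \<Longrightarrow> L2_inner F g = 0"
  shows "AE z in circle. model_proj \<beta> F z = 0"
proof -
  define g where "g = model_proj \<beta> F"
  have "(\<lambda>z. 0) \<in> model_space \<beta>"
    using H2_const[of 0] by (simp add: model_space_def L2_inner_def)
  then have "\<exists>g. g \<in> model_space \<beta> \<and> (\<forall>h\<in>model_space \<beta>. L2_inner (\<lambda>z. F z - g z) h = 0)"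
    using 0 by (intro exI[of _ "\<lambda>z. 0"]) simp
  from someI_ex[OF this]
  have g: "g \<in> model_space \<beta>" and orth: "L2_inner (\<lambda>z. F z - g z) g = 0"
    unfolding g_def model_proj_def by blast+
  have gL2: "g \<in> L2" using g by (simp add: model_space_def H2_imp_L2)
  have "L2_inner g g = 0"
    using L2_inner_lin[OF F gL2 gL2, of 1 "-1"] orth 0[OF g] by simp
  then have "L2_norm g = 0"
    by (simp add: L2_inner_self)
  then show ?thesis
    using L2_norm_eq_0_iff[OF gL2] by (simp add: g_def)
qed

theorem proposition2p2:
  fixes k :: nat and \<alpha> \<beta> \<phi> :: "complex \<Rightarrow> complex"
  assumes "k \<ge> 1"
    and "inner_function \<alpha>" and "inner_function \<beta>"
    and "\<phi> \<in> L2"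
    and "\<phi> \<in> L2_plus (L2_cnj (L2_mult (bval \<alpha>) H2)) (L2_mult (slant_adj k (bval \<beta>)) H2)"
  shows "\<forall>f\<in>model_space_inf \<alpha>. AE z in circle. trunc_slant k \<alpha> \<beta> \<phi> f z = 0"
proof
  fix f assume f: "f \<in> model_space_inf \<alpha>"
  note k = \<open>k \<ge> 1\<close>
  obtain q v u h1 h2 where q: "q \<in> L2" and v: "v \<in> L2" and u: "u \<in> L2" and h1: "h1 \<in> H2" and h2: "h2 \<in> H2"
    and \<phi>_eq: "AE z in circle. \<phi> z = q z + v z" and q_eq: "AE z in circle. q z = cnj (u z)"
    and u_eq: "AE z in circle. u z = bval \<alpha> z * h1 z"
    and v_eq: "AE z in circle. v z = bval \<beta> (z ^ k) * h2 z"
    using assms(5) by (auto simp: L2_plus_def L2_cnj_def L2_mult_def slant_adj_def)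
  have f_orth: "L2_inner f g = 0" if "g \<in> L2_mult (bval \<alpha>) H2" for g
    using f that by (simp add: model_space_inf_def model_space_def)
  have f_Hinf: "f \<in> Hinf" and fL2: "f \<in> L2"
    using f by (auto simp: model_space_inf_def model_space_def H2_imp_L2)
  obtain B where B: "AE z in circle. cmod (f z) \<le> B"
    using Hinf_bounded[OF f_Hinf] by blast
  \<comment> \<open>Here boundedness of \<open>f\<close> enters: it keeps products with arbitrary
    \<open>L2\<close> functions in \<open>L2\<close>.\<close>
  have mult_f: "(\<lambda>z. w z * f z) \<in> L2" if "w \<in> L2" for w
    using L2_mult_bounded[OF that L2_measurable[OF fL2] B] by (simp add: mult.commute)
  obtain b where b: "b \<in> borel_measurable circle" "AE z in circle. bval \<beta> z = b z"
    "AE z in circle. cmod (b z) = 1"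
    using inner_function_boundary[OF assms(3)] .
  have b_le: "AE z in circle. cmod (b z) \<le> 1"
    using b(3) by eventually_elim simp
  have slant_L2: "slant_op k w \<in> L2" if "w \<in> L2" for w
    using slant_op_properties(1)[OF k] that by (simp add: L2_bounded_op_def)
  have "L2_inner (slant_op k (\<lambda>z. \<phi> z * f z)) g = 0" if g: "g \<in> model_space \<beta>" for g
  proof -
    have gH2: "g \<in> H2" and gL2: "g \<in> L2"
      and g_orth: "\<And>h. h \<in> L2_mult (bval \<beta>) H2 \<Longrightarrow> L2_inner g h = 0"
      using g by (auto simp: model_space_def H2_imp_L2)
    have gk: "(\<lambda>z. g (z ^ k)) \<in> L2"
      by (rule L2_compose_power[OF k gL2])
    have "L2_inner (slant_op k (\<lambda>z. \<phi> z * f z)) g = L2_inner (\<lambda>z. \<phi> z * f z) (\<lambda>z. g (z ^ k))"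
      by (rule slant_op_adjoint[OF k mult_f[OF assms(4)] gL2])
    also have "\<dots> = L2_inner (\<lambda>z. q z * f z + v z * f z) (\<lambda>z. g (z ^ k))"
    proof (rule L2_inner_cong_AE)
      show "AE z in circle. \<phi> z * f z = q z * f z + v z * f z"
        using \<phi>_eq by eventually_elim (simp add: distrib_right)
    qed (intro mult_f assms(4) L2_add q v gk | simp)+
    also have "\<dots> = L2_inner (\<lambda>z. q z * f z) (\<lambda>z. g (z ^ k)) + L2_inner (\<lambda>z. v z * f z) (\<lambda>z. g (z ^ k))"
      using L2_inner_lin[OF mult_f[OF q] mult_f[OF v] gk, of 1 1] by simp
    also have "L2_inner (\<lambda>z. q z * f z) (\<lambda>z. g (z ^ k)) = 0"
    proof -
      \<comment> \<open>\<open>q\<close> equals \<open>cnj u\<close> only almost everywhere;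
        \<open>w\<close> is the representative of \<open>q * f\<close> with an explicit
        formula.\<close>
      define w where "w z = cnj (u z) * f z" for z
      have w: "w \<in> L2"
        unfolding w_def by (intro mult_f L2_cnj_fun u)
      have "L2_inner (\<lambda>z. z ^ n) (slant_op k w) = 0" for n
      proof -
        have un: "(\<lambda>z. (z ^ k) ^ n * u z) \<in> L2"
          by (rule L2_mult_bounded[OF u, of _ 1])
            (auto intro!: continuous_imp_borel_circle continuous_intros AE_I2 simp: norm_power)
        have "(\<lambda>z. h1 z * z ^ (k * n)) \<in> H2"
          by (rule H2_mult_Hinf[OF h1 Hinf_power])
        \<comment> \<open>Multiplication by \<open>z ^ (k * n)\<close> keeps \<open>u\<close> inside
          \<open>\<alpha> H2\<close>, to which \<open>f\<close> is orthogonal.\<close>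
        moreover have "AE z in circle. (z ^ k) ^ n * u z = bval \<alpha> z * (h1 z * z ^ (k * n))"
          using u_eq by eventually_elim (simp add: power_mult)
        ultimately have "L2_inner f (\<lambda>z. (z ^ k) ^ n * u z) = 0"
          using un by (intro f_orth) (auto simp: L2_mult_def)
        moreover have "L2_inner (slant_op k w) (\<lambda>z. z ^ n) = L2_inner w (\<lambda>z. (z ^ k) ^ n)"
          by (rule slant_op_adjoint[OF k w L2_power])
        moreover have "L2_inner w (\<lambda>z. (z ^ k) ^ n) = L2_inner f (\<lambda>z. (z ^ k) ^ n * u z)"
          by (simp add: L2_inner_def w_def mult_ac)
        ultimately show ?thesis
          using L2_inner_commute[of "\<lambda>z. z ^ n" "slant_op k w"] by simp
      qed
      then have "L2_inner g (slant_op k w) = 0"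
        by (rule H2_inner_eq_0[OF gH2 slant_L2[OF w]])
      then have "L2_inner w (\<lambda>z. g (z ^ k)) = 0"
        using slant_op_adjoint[OF k w gL2] L2_inner_commute[of "slant_op k w" g] by simp
      moreover have "L2_inner (\<lambda>z. q z * f z) (\<lambda>z. g (z ^ k)) = L2_inner w (\<lambda>z. g (z ^ k))"
      proof (rule L2_inner_cong_AE)
        show "AE z in circle. q z * f z = w z"
          using q_eq by eventually_elim (simp add: w_def)
      qed (auto intro: mult_f q gk w)
      ultimately show ?thesis by simp
    qed
    also have "L2_inner (\<lambda>z. v z * f z) (\<lambda>z. g (z ^ k)) = 0"
    proof -
      \<comment> \<open>Moving the factor \<open>bval \<beta> (z ^ k)\<close> of \<open>v\<close> to
        the other side of the pairing turns \<open>g (z ^ k)\<close> into \<open>d (z ^ k)\<close>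
        and leaves \<open>h2 * f\<close>, which lies in \<open>H2\<close>.\<close>
      define d where "d z = cnj (b z) * g z" for z
      have cnj_b: "(\<lambda>z. cnj (b z)) \<in> borel_measurable circle"
        using borel_measurable_continuous_on[of cnj b circle] b(1) by (simp add: continuous_on_cnj)
      have d: "d \<in> L2"
        unfolding d_def by (rule L2_mult_bounded[OF gL2 cnj_b]) (use b_le in simp)
      have "L2_inner (\<lambda>z. z ^ n) (\<lambda>z. d (z ^ k)) = 0" for n
      proof -
        \<comment> \<open>The adjoint formula is read backwards, because the value of
          \<open>slant_op k\<close> on a monomial is known.\<close>
        have "L2_inner (\<lambda>z. z ^ n) (\<lambda>z. d (z ^ k)) = L2_inner (slant_op k (\<lambda>z. z powi int n)) d"
          using slant_op_adjoint[OF k L2_power d, of n] by simp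
        also have "\<dots> = L2_inner (\<lambda>z. if k dvd n then z ^ (n div k) else 0) d"
        proof (rule L2_inner_cong_AE)
          show "AE z in circle. slant_op k (\<lambda>z. z powi int n) z = (if k dvd n then z ^ (n div k) else 0)"
            using slant_op_properties(2)[OF k, of "int n"]
            by (simp only: zdiv_int[symmetric] power_int_of_nat int_dvd_int_iff)
          show "(\<lambda>z. if k dvd n then z ^ (n div k) else 0) \<in> L2"
            by (cases "k dvd n") (simp_all add: L2_power H2_imp_L2[OF H2_const])
        qed (auto intro: slant_L2 L2_power d)
        also have "\<dots> = 0"
        proof (cases "k dvd n")
          case True
          define m where "m = n div k"
          \<comment> \<open>\<open>b * z ^ m\<close> represents an element of
            \<open>\<beta> H2\<close>, so it is orthogonal to \<open>g\<close>; shifting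
            \<open>cnj b\<close> across shows that \<open>z ^ m\<close> is orthogonal to
            \<open>d\<close>.\<close>
          have bm: "(\<lambda>z. b z * z ^ m) \<in> L2"
            by (rule L2_mult_bounded[OF L2_power b(1) b_le])
          have "AE z in circle. b z * z ^ m = bval \<beta> z * z ^ m"
            using b(2) by eventually_elim simp
          then have "\<exists>h\<in>H2. AE z in circle. b z * z ^ m = bval \<beta> z * h z"
            by (intro bexI[of _ "\<lambda>z. z ^ m"] H2_power)
          with bm have "(\<lambda>z. b z * z ^ m) \<in> L2_mult (bval \<beta>) H2"
            unfolding L2_mult_def by (intro CollectI conjI)
          then have "L2_inner g (\<lambda>z. b z * z ^ m) = 0"
            by (rule g_orth)
          moreover have "L2_inner d (\<lambda>z. z ^ m) = L2_inner g (\<lambda>z. b z * z ^ m)"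
            by (simp add: L2_inner_def d_def mult_ac)
          ultimately show ?thesis
            using True L2_inner_commute[of "\<lambda>z. z ^ m" d] by (simp add: m_def)
        qed (simp add: L2_inner_def)
        finally show ?thesis .
      qed
      then have "L2_inner (\<lambda>z. h2 z * f z) (\<lambda>z. d (z ^ k)) = 0"
        by (rule H2_inner_eq_0[OF H2_mult_Hinf[OF h2 f_Hinf] L2_compose_power[OF k d]])
      moreover have "L2_inner (\<lambda>z. v z * f z) (\<lambda>z. g (z ^ k)) = L2_inner (\<lambda>z. h2 z * f z) (\<lambda>z. d (z ^ k))"
        unfolding L2_inner_def
      proof (rule integral_cong_AE)
        show "(\<lambda>z. v z * f z * cnj (g (z ^ k))) \<in> borel_measurable circle"
          using L2_inner_integrable[OF mult_f[OF v] gk] by (rule borel_measurable_integrable)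
        show "(\<lambda>z. h2 z * f z * cnj (d (z ^ k))) \<in> borel_measurable circle"
          using L2_inner_integrable[OF mult_f[OF H2_imp_L2[OF h2]] L2_compose_power[OF k d]]
          by (rule borel_measurable_integrable)
        \<comment> \<open>\<open>bval \<beta>\<close> and \<open>b\<close> must agree at
          \<open>z ^ k\<close> for almost every \<open>z\<close>, which is where invariance under
          the power map is used.\<close>
        show "AE z in circle. v z * f z * cnj (g (z ^ k)) = h2 z * f z * cnj (d (z ^ k))"
          using v_eq AE_circle_power[OF k b(2)] by eventually_elim (simp add: d_def)
      qed
      ultimately show ?thesis by simp
    qed
    finally show ?thesis by simp
  qed
  then have "AE z in circle. model_proj \<beta> (slant_op k (\<lambda>z. \<phi> z * f z)) z = 0"
    by (rule model_proj_eq_0[OF slant_L2[OF mult_f[OF assms(4)]]])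
  then show "AE z in circle. trunc_slant k \<alpha> \<beta> \<phi> f z = 0"
    using f by (simp add: trunc_slant_def)
qed

end
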